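(* Let $\alpha\in(0,2)$, $1<p\le q<\infty$, and let $\mu$ be a nonnegative Radon measure on $\mathbb{R}^{n+1}_+$. Consider the embedding $$(\ast)\qquad \|P_\alpha f\|_{L^q(\mathbb{R}^{n+1}_+,\mu)}\le C\,\|f\|_{L^p(\mathbb{R}^n)}\quad\text{for all } f\in L^p(\mathbb{R}^n),\ \text{with some constant } C<\infty .$$ (i) $(\ast)$ holds if and only if $$\sup_{\lambda\in(0,\infty)}\frac{\lambda^{p/q}}{c_{\alpha,p}(\mu;\lambda)}<\infty.$$ (ii) If moreover $1<p<q<\infty$, then the condition in (i) can be replaced by $$\sup_{(r,x_0,t_0)\in(0,\infty)\times\mathbb{R}^{n+1}_+,\ t_0\lesssim r}\frac{\mu(B_r(x_0,t_0))}{r^{qn/p}}<\infty,$$ that is, $(\ast)$ holds if and only if this supremum is finite; here $t_0\lesssim r$ means $t_0\le c\,r$ for a fixed constant $c>0$.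
   Context: $\mathbb{R}^{n+1}_+:=\mathbb{R}^n\times(0,\infty)$, $n\ge1$. For $\alpha\in(0,2)$, $p^\alpha_t(x)=c(n,\alpha)\,t^\alpha(|x|^2+t^2)^{-(n+\alpha)/2}$ with $c(n,\alpha)=\frac{\Gamma((n+\alpha)/2)}{\pi^{n/2}\Gamma(\alpha/2)}$, and $P_\alpha f(x,t)=\int_{\mathbb{R}^n}p^\alpha_t(x-y)f(y)\,dy$ is the Caffarelli-Silvestre extension. The $L^p$-capacity is $C^{\alpha,p}_{\mathbb{R}^{n+1}_+}(E):=\inf\{\|f\|^p_{L^p(\mathbb{R}^n)}:\ f\ge0,\ P_\alpha f(x,t)\ge1\text{ for all }(x,t)\in E\}$ for $E\subset\mathbb{R}^{n+1}_+$. For $\lambda>0$, $$c_{\alpha,p}(\mu;\lambda):=\inf\{C^{\alpha,p}_{\mathbb{R}^{n+1}_+}(K):\ K\subset\mathbb{R}^{n+1}_+\text{ compact},\ \mu(K)\ge\lambda\},$$ with the usual conventions $\inf\varnothing=+\infty$, $a/\infty=0$, and $a/0=\infty$ for $a>0$. For $x_0\in\mathbb{R}^n$, $t_0\ge0$, $r>0$: $B_r(x_0,t_0)=\{(x,t)\in\mathbb{R}^{n+1}_+:\ |x-x_0|<r/2,\ r<t-t_0<2r\}$. *)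

theory Defs
  imports "HOL-Analysis.Analysis"
begin

(* Used only for exponents r > 0, where top powr r = top. *)
definition ennreal_powr :: "ennreal \<Rightarrow> real \<Rightarrow> ennreal" where
  "ennreal_powr a r = (if a = top then top else ennreal (enn2real a powr r))"

definition Lp_norm :: "'a measure \<Rightarrow> real \<Rightarrow> ('a \<Rightarrow> real) \<Rightarrow> ennreal" where
  "Lp_norm M p f = ennreal_powr (\<integral>\<^sup>+ x. ennreal (\<bar>f x\<bar> powr p) \<partial>M) (1 / p)"

definition Lp_space :: "'a measure \<Rightarrow> real \<Rightarrow> ('a \<Rightarrow> real) set" where
  "Lp_space M p = {f \<in> borel_measurable M. Lp_norm M p f < \<infinity>}"

definition radon_measure_on :: "'a::topological_space set \<Rightarrow> 'a measure \<Rightarrow> bool" where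
  "radon_measure_on X \<mu> \<longleftrightarrow>
     sets \<mu> = sets (restrict_space borel X) \<and>
     (\<forall>K. compact K \<and> K \<subseteq> X \<longrightarrow> emeasure \<mu> K < \<infinity>) \<and>
     (\<forall>A\<in>sets \<mu>. emeasure \<mu> A =
        (INF U\<in>{U. openin (top_of_set X) U \<and> A \<subseteq> U}. emeasure \<mu> U)) \<and>
     (\<forall>U. openin (top_of_set X) U \<longrightarrow> emeasure \<mu> U =
        (SUP K\<in>{K. compact K \<and> K \<subseteq> U}. emeasure \<mu> K))"

definition upper_half_space :: "((real^'n) \<times> real) set" where
  "upper_half_space = UNIV \<times> {0<..}"

definition cs_const :: "nat \<Rightarrow> real \<Rightarrow> real" where
  "cs_const n \<alpha> = Gamma ((real n + \<alpha>) / 2) / (pi powr (real n / 2) * Gamma (\<alpha> / 2))"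

definition cs_kernel :: "real \<Rightarrow> real \<Rightarrow> real^'n \<Rightarrow> real" where
  "cs_kernel \<alpha> t x =
     cs_const CARD('n) \<alpha> * t powr \<alpha> *
       ((norm x)\<^sup>2 + t\<^sup>2) powr (- ((real CARD('n) + \<alpha>) / 2))"

(* The Bochner integral is 0 by convention when the integrand is not integrable. This
   never happens for f in Lp with 1 <= p and t > 0, by Hoelder's inequality. *)
definition cs_extension :: "real \<Rightarrow> (real^'n \<Rightarrow> real) \<Rightarrow> (real^'n) \<times> real \<Rightarrow> real" where
  "cs_extension \<alpha> f = (\<lambda>(x, t). \<integral>y. cs_kernel \<alpha> t (x - y) * f y \<partial>lebesgue)"

(* A function f that is not in Lp contributes the value top to the infimum. *)
definition Lp_capacity :: "real \<Rightarrow> real \<Rightarrow> ((real^'n) \<times> real) set \<Rightarrow> ennreal" where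
  "Lp_capacity \<alpha> p E =
     (INF f\<in>{f \<in> borel_measurable lebesgue.
              (\<forall>y. 0 \<le> f y) \<and> (\<forall>z\<in>E. 1 \<le> cs_extension \<alpha> f z)}.
        ennreal_powr (Lp_norm lebesgue p f) p)"

definition min_capacity ::
  "real \<Rightarrow> real \<Rightarrow> ((real^'n) \<times> real) measure \<Rightarrow> real \<Rightarrow> ennreal" where
  "min_capacity \<alpha> p \<mu> l =
     (INF K\<in>{K. compact K \<and> K \<subseteq> upper_half_space \<and> ennreal l \<le> emeasure \<mu> K}.
        Lp_capacity \<alpha> p K)"

definition cs_box :: "real \<Rightarrow> real^'n \<Rightarrow> real \<Rightarrow> ((real^'n) \<times> real) set" where
  "cs_box r x\<^sub>0 t\<^sub>0 =
     {(x, t) \<in> upper_half_space. norm (x - x\<^sub>0) < r / 2 \<and> r < t - t\<^sub>0 \<and> t - t\<^sub>0 < 2 * r}"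

definition cs_embedding ::
  "real \<Rightarrow> real \<Rightarrow> real \<Rightarrow> ((real^'n) \<times> real) measure \<Rightarrow> bool" where
  "cs_embedding \<alpha> p q \<mu> \<longleftrightarrow>
     (\<exists>C\<ge>0. \<forall>f\<in>Lp_space lebesgue p.
        Lp_norm \<mu> q (cs_extension \<alpha> f) \<le> ennreal C * Lp_norm lebesgue p f)"

end

theory Submission
  imports Defs
begin

text \<open>
  Every condition is equivalent to a Carleson condition on tents over balls,
  $\mu(B(x,R) \times (0,R)) \le A\,(R^n)^{q/p}$.
  The embedding gives the capacity bound by Chebyshev's inequality. The capacity of a compact subset
  of a tent is at most a multiple of $R^n$ (test with a multiple of the indicator of $B(x,2R)$), so the
  capacity bound gives the Carleson condition. Conversely, $P_\alpha f(x,t)$ is bounded by a multiple of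
  the supremum of the averages of $|f|$ over the balls $B(x,R)$, $R > t$; hence a superlevel set of
  $P_\alpha f$ lies in the union of the tents over balls with a large average, whose measure the Vitali
  covering lemma controls, and summing over dyadic levels gives the embedding.
  For $p < q$, a tent is cut into layers at geometrically decreasing heights. Covering a layer by boxes
  costs $(\sigma^n)^{q/p-1} R^n$ at height $\sigma$, which is summable because $q/p > 1$.
\<close>

text \<open>The obstacle is that for \<open>s = q / p > 1\<close> the power \<open>V powr s\<close>
  of a volume is not additive over disjoint balls. Both covering arguments split it as
  \<open>V powr (s - 1) * V\<close>: the second factor sums over the disjoint Vitali balls, the
  first is bounded uniformly. For tents the uniform bound comes from \<open>f\<close> itself: a ball
  whose average of |f| exceeds 2L has volume at most L^(-p) times the integral of |f|^p. For layers
  it comes from the height. In the sum over levels all powers of L then combine to L^(p-1), whatever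
  \<open>s\<close> is, and p > 1 makes the contribution of the low levels converge.\<close>

section \<open>Countable unions, ball volumes and a dyadic geometric sum\<close>

text \<open>The indicator of a union is at most the sum of the indicators. The index set is an
  arbitrary countable set because the Vitali subfamily comes without an enumeration.\<close>

lemma emeasure_UN_le_nn_integral_count_space:
  assumes I: "countable I" and F: "\<And>i. i \<in> I \<Longrightarrow> F i \<in> sets M"
  shows "emeasure M (\<Union>i\<in>I. F i) \<le> (\<integral>\<^sup>+i. emeasure M (F i) \<partial>count_space I)"
proof -
  have "emeasure M (\<Union>i\<in>I. F i) = (\<integral>\<^sup>+x. indicator (\<Union>i\<in>I. F i) x \<partial>M)"
    using I F by (intro nn_integral_indicator[symmetric] sets.countable_UN') auto
  also have "\<dots> \<le> (\<integral>\<^sup>+x. \<integral>\<^sup>+i. indicator (F i) x \<partial>count_space I \<partial>M)"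
  proof (rule nn_integral_mono)
    fix x
    show "(indicator (\<Union>i\<in>I. F i) x :: ennreal) \<le> (\<integral>\<^sup>+i. indicator (F i) x \<partial>count_space I)"
    proof (cases "x \<in> (\<Union>i\<in>I. F i)")
      case True
      then obtain i where "i \<in> I" "x \<in> F i" by blast
      then show ?thesis
        using nn_integral_ge_point[of i I "\<lambda>i. indicator (F i) x :: ennreal"] by (simp add: indicator_def)
    qed simp
  qed
  also have "\<dots> = (\<integral>\<^sup>+i. \<integral>\<^sup>+x. indicator (F i) x \<partial>M \<partial>count_space I)"
    using I F by (intro nn_integral_count_space_nn_integral) auto
  also have "\<dots> = (\<integral>\<^sup>+i. emeasure M (F i) \<partial>count_space I)"
    using F by (intro nn_integral_cong) auto
  finally show ?thesis .
qed

lemma unit_ball_vol_neq_0 [simp]: "0 \<le> n \<Longrightarrow> unit_ball_vol n \<noteq> 0"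
  using unit_ball_vol_pos[of n] by linarith

lemma emeasure_lebesgue_ball:
  fixes x :: "real^'n"
  assumes "0 \<le> r"
  shows "emeasure lebesgue (ball x r) = ennreal (unit_ball_vol (real CARD('n)) * r ^ CARD('n))"
  using emeasure_ball[OF assms, of x] by simp

text \<open>A geometric sum over all small levels is comparable to its largest term, whose index is
  at most \<open>m\<close> with 2^m at most 2a. In \<open>sum_levels_le\<close> it is used with a =
  |f y| and s = p - 1, so s > 0 is the condition p > 1.\<close>

lemma geometric_sum_int_le:
  fixes a s :: real
  assumes a: "0 \<le> a" and s: "0 < s"
  shows "(\<integral>\<^sup>+j. ennreal (2 powr (of_int j * s)) * indicator {j. 2 powr (of_int j - 1) < a} j
            \<partial>count_space (UNIV :: int set))
         \<le> ennreal (2 powr s / (1 - 2 powr (-s)) * a powr s)"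
proof (cases "a = 0")
  case True
  have "\<not> 2 powr (real_of_int j - 1) < 0" for j by (simp add: not_less)
  then show ?thesis using True by simp
next
  case False
  define m where "m = \<lceil>log 2 a\<rceil>"
  have pos: "0 < a" using a False by simp
  have sub: "j \<le> m" if "2 powr (real_of_int j - 1) < a" for j :: int
  proof -
    have "real_of_int j - 1 < log 2 a" using that pos by (simp add: less_log_iff)
    then have "real_of_int j < real_of_int m + 1" unfolding m_def by linarith
    then show ?thesis by linarith
  qed
  \<comment> \<open>Counting down from \<open>m\<close> turns the sum over the integers up to
    \<open>m\<close> into a geometric series with ratio 2^(-s).\<close>
  have bij: "bij_betw (\<lambda>k::nat. m - int k) UNIV {..m}"
    by (rule bij_betwI[where g = "\<lambda>j. nat (m - j)"]) auto
  define \<rho> where "\<rho> = 2 powr (-s)"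
  have \<rho>: "0 < \<rho>" "\<rho> < 1" using s by (auto simp: \<rho>_def powr_less_one)
  have pw: "2 powr (real_of_int (m - int k) * s) = 2 powr (of_int m * s) * \<rho> ^ k" for k
    by (simp add: \<rho>_def powr_realpow[symmetric] powr_powr powr_add[symmetric] algebra_simps)
  have "(\<integral>\<^sup>+j. ennreal (2 powr (of_int j * s)) * indicator {j. 2 powr (of_int j - 1) < a} j
            \<partial>count_space UNIV)
      \<le> (\<integral>\<^sup>+j. ennreal (2 powr (of_int j * s)) * indicator {..m} j \<partial>count_space UNIV)"
    by (intro nn_integral_mono) (auto simp: indicator_def dest: sub)
  also have "\<dots> = (\<integral>\<^sup>+j. ennreal (2 powr (of_int j * s)) \<partial>count_space {..m})"
    by (subst nn_integral_count_space_indicator) auto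
  also have "\<dots> = (\<integral>\<^sup>+k. ennreal (2 powr (of_int (m - int k) * s)) \<partial>count_space UNIV)"
    by (rule nn_integral_bij_count_space[OF bij, symmetric])
  also have "\<dots> = (\<Sum>k. ennreal (2 powr (of_int m * s)) * ennreal (\<rho> ^ k))"
    using \<rho> by (simp only: nn_integral_count_space_nat pw)
      (simp add: ennreal_mult)
  also have "\<dots> = ennreal (2 powr (of_int m * s)) * ennreal (1 / (1 - \<rho>))"
    using \<rho> by (simp add: suminf_ennreal_eq[OF _ geometric_sums] del: suminf_ennreal)
  also have "\<dots> = ennreal (2 powr (of_int m * s) / (1 - \<rho>))"
    using \<rho> by (simp flip: ennreal_mult')
  also have "\<dots> \<le> ennreal (2 powr s / (1 - \<rho>) * a powr s)"
  proof -
    have "2 powr (of_int m * s) = (2 powr of_int m) powr s" by (simp add: powr_powr)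
    also have "\<dots> \<le> (2 * a) powr s"
    proof (rule powr_mono2)
      have "real_of_int m \<le> log 2 a + 1" unfolding m_def by linarith
      then have "2 powr real_of_int m \<le> 2 powr (log 2 a + 1)" by simp
      also have "\<dots> = 2 * a" using pos by (simp add: powr_add)
      finally show "2 powr real_of_int m \<le> 2 * a" .
    qed (use s in auto)
    finally show ?thesis using \<rho> by (intro ennreal_leI) (simp add: powr_mult divide_right_mono)
  qed
  finally show ?thesis unfolding \<rho>_def .
qed

section \<open>Kernel bounds and domination of the extension by averages\<close>

lemma cs_const_pos: "0 < \<alpha> \<Longrightarrow> 0 < cs_const n \<alpha>"
  unfolding cs_const_def by (intro divide_pos_pos mult_pos_pos Gamma_real_pos) auto

lemma cs_kernel_nonneg: "0 < \<alpha> \<Longrightarrow> 0 \<le> cs_kernel \<alpha> t x"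
  unfolding cs_kernel_def using cs_const_pos[of \<alpha> "CARD('a)"] by simp

lemma cs_kernel_measurable [measurable]:
  "(\<lambda>y::real^'n. cs_kernel \<alpha> t (x - y)) \<in> borel_measurable borel"
  unfolding cs_kernel_def by measurable

lemma square_powr_minus_half: "0 < t \<Longrightarrow> (t\<^sup>2) powr (- (e / 2)) = t powr (- e)" for t e :: real
proof -
  assume "0 < t"
  then have "(t\<^sup>2) powr (- (e / 2)) = (t powr 2) powr (- (e / 2))" by simp
  also have "\<dots> = t powr (- e)" by (simp only: powr_powr) simp
  finally show ?thesis .
qed

text \<open>Within distance t of the origin |y|^2 + t^2 is at most 2 t^2, so the kernel is
  comparable to t^(-n) there. This feeds the lower bound for the extension of an indicator.\<close>

lemma cs_kernel_ge:
  fixes y :: "real^'n"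
  assumes \<alpha>: "0 < \<alpha>" and t: "0 < t" and y: "norm y \<le> t"
  shows "cs_const CARD('n) \<alpha> * 2 powr (- ((real CARD('n) + \<alpha>) / 2)) / t ^ CARD('n) \<le> cs_kernel \<alpha> t y"
proof -
  let ?e = "(real CARD('n) + \<alpha>) / 2"
  have S: "0 < (norm y)\<^sup>2 + t\<^sup>2" "(norm y)\<^sup>2 + t\<^sup>2 \<le> 2 * t\<^sup>2"
    using t y by (auto intro: add_nonneg_pos power_mono)
  have "(2 * t\<^sup>2) powr (- ?e) \<le> ((norm y)\<^sup>2 + t\<^sup>2) powr (- ?e)"
    using S \<alpha> by (intro powr_mono2') auto
  moreover have "(t\<^sup>2) powr (- ?e) = t powr (- (real CARD('n) + \<alpha>))"
    using t by (rule square_powr_minus_half)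
  moreover have "t powr \<alpha> * t powr (- (real CARD('n) + \<alpha>)) = 1 / t ^ CARD('n)"
    using t by (simp add: powr_realpow[symmetric] powr_add[symmetric] powr_minus_divide)
  moreover have "t powr \<alpha> * (2 * t\<^sup>2) powr (- ?e)
      = 2 powr (- ?e) * (t powr \<alpha> * (t\<^sup>2) powr (- ?e))"
    by (simp add: powr_mult mult.left_commute)
  moreover have "t powr \<alpha> * (2 * t\<^sup>2) powr (- ?e) \<le> t powr \<alpha> * ((norm y)\<^sup>2 + t\<^sup>2) powr (- ?e)"
    using calculation(1) by (rule mult_left_mono) simp
  ultimately have "2 powr (- ?e) / t ^ CARD('n) \<le> t powr \<alpha> * ((norm y)\<^sup>2 + t\<^sup>2) powr (- ?e)"
    by simp
  from mult_left_mono[OF this less_imp_le[OF cs_const_pos[OF \<alpha>, of "CARD('n)"]]]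
  show ?thesis unfolding cs_kernel_def by (simp add: mult.assoc)
qed

text \<open>\<open>k\<close> indexes the shell 2^k t <= |y| < 2^(k+1) t, with k = 0 standing for the
  whole ball of radius 2t. In either case |y|^2 + t^2 is at least (2^k t)^2; for k = 0 the summand
  t^2 alone suffices.\<close>

lemma cs_kernel_le_dyadic:
  fixes y :: "real^'n"
  assumes \<alpha>: "0 < \<alpha>" and t: "0 < t"
  obtains k :: nat where "norm y < 2 ^ (k + 1) * t"
    "cs_kernel \<alpha> t y \<le> cs_const CARD('n) \<alpha> * (2 ^ k) powr (- (real CARD('n) + \<alpha>)) / t ^ CARD('n)"
proof -
  let ?e = "(real CARD('n) + \<alpha>) / 2"
  obtain m :: nat where "norm y / t < 2 ^ m" using real_arch_pow[of 2] by auto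
  then have "norm y < 2 ^ m * t" using t by (simp add: field_simps)
  also have "\<dots> \<le> 2 ^ (m + 1) * t" using t by simp
  finally have m: "norm y < 2 ^ (m + 1) * t" .
  define k where "k = (LEAST k. norm y < 2 ^ (k + 1) * t)"
  have k: "norm y < 2 ^ (k + 1) * t" unfolding k_def by (rule LeastI[of _ m]) (rule m)
  have *: "k = 0 \<or> 2 ^ k * t \<le> norm y"
  proof (cases k)
    case (Suc i)
    then have "i < k" by simp
    then have "\<not> norm y < 2 ^ (i + 1) * t" unfolding k_def by (rule not_less_Least)
    then show ?thesis using Suc by simp
  qed simp
  have S: "(2 ^ k * t)\<^sup>2 \<le> (norm y)\<^sup>2 + t\<^sup>2"
  proof (cases "k = 0")
    case False
    then have "(2 ^ k * t)\<^sup>2 \<le> (norm y)\<^sup>2" using * t by (intro power_mono) auto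
    then show ?thesis by (simp add: add_increasing2)
  qed simp
  have "((norm y)\<^sup>2 + t\<^sup>2) powr (- ?e) \<le> ((2 ^ k * t)\<^sup>2) powr (- ?e)"
    using S \<alpha> t by (intro powr_mono2') auto
  also have "\<dots> = (2 ^ k * t) powr (- (real CARD('n) + \<alpha>))"
    using t by (intro square_powr_minus_half) simp
  finally have "t powr \<alpha> * ((norm y)\<^sup>2 + t\<^sup>2) powr (- ?e)
      \<le> t powr \<alpha> * ((2 ^ k) powr (- (real CARD('n) + \<alpha>)) * t powr (- (real CARD('n) + \<alpha>)))"
    by (intro mult_left_mono) (simp_all add: powr_mult)
  also have "\<dots> = (2 ^ k) powr (- (real CARD('n) + \<alpha>)) / t ^ CARD('n)"
  proof -
    have "t powr \<alpha> * t powr (- (real CARD('n) + \<alpha>)) = 1 / t ^ CARD('n)"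
      using t by (simp add: powr_realpow[symmetric] powr_add[symmetric] powr_minus_divide)
    then show ?thesis
      using mult.left_commute[of "t powr \<alpha>" "(2 ^ k) powr (- (real CARD('n) + \<alpha>))" "t powr (- (real CARD('n) + \<alpha>))"]
      by simp
  qed
  finally have "t powr \<alpha> * ((norm y)\<^sup>2 + t\<^sup>2) powr (- ?e)
      \<le> (2 ^ k) powr (- (real CARD('n) + \<alpha>)) / t ^ CARD('n)" .
  from mult_left_mono[OF this less_imp_le[OF cs_const_pos[OF \<alpha>, of "CARD('n)"]]]
  have "cs_kernel \<alpha> t y \<le> cs_const CARD('n) \<alpha> * (2 ^ k) powr (- (real CARD('n) + \<alpha>)) / t ^ CARD('n)"
    unfolding cs_kernel_def by (simp add: mult.assoc)
  with k that show ?thesis by simp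
qed

text \<open>The sum over k of the shell contributions \<open>cs_const n \<alpha> * unit_ball_vol n *
  2 ^ n * 2 powr (- \<alpha> * k)\<close>.\<close>

definition dyadic_const :: "nat \<Rightarrow> real \<Rightarrow> real" where
  "dyadic_const n \<alpha> = cs_const n \<alpha> * unit_ball_vol n * 2 ^ n / (1 - 2 powr (- \<alpha>))"

lemma dyadic_const_pos: "0 < \<alpha> \<Longrightarrow> 0 < dyadic_const n \<alpha>"
  unfolding dyadic_const_def
  by (intro divide_pos_pos mult_pos_pos) (auto simp: cs_const_pos powr_less_one)

text \<open>The kernel is dominated by weights \<open>a k\<close> on the balls of radius 2^(k+1) t,
  all larger than t, so \<open>avg\<close> applies to each. The volume of the k-th ball cancels the
  decay of \<open>a k\<close> up to the factor 2^(-\<alpha> k), which is summable.\<close>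

lemma nn_integral_cs_kernel_le:
  fixes f :: "real^'n \<Rightarrow> real" and x :: "real^'n"
  assumes \<alpha>: "0 < \<alpha>" and t: "0 < t" and f[measurable]: "f \<in> borel_measurable lebesgue" and L: "0 \<le> L"
    and avg: "\<And>R. t < R \<Longrightarrow> (\<integral>\<^sup>+y. ennreal \<bar>f y\<bar> * indicator (ball x R) y \<partial>lebesgue)
                \<le> ennreal L * emeasure lebesgue (ball x R)"
  shows "(\<integral>\<^sup>+y. ennreal (cs_kernel \<alpha> t (x - y) * \<bar>f y\<bar>) \<partial>lebesgue) \<le> ennreal (dyadic_const CARD('n) \<alpha> * L)"
proof -
  let ?n = "CARD('n)" and ?\<omega> = "unit_ball_vol (real CARD('n))" and ?c = "cs_const CARD('n) \<alpha>"
  define a where "a k = ?c * (2 ^ k) powr (- (real ?n + \<alpha>)) / t ^ ?n" for k :: nat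
  define R where "R k = 2 ^ (k + 1) * t" for k :: nat
  have a0: "0 \<le> a k" for k unfolding a_def using cs_const_pos[OF \<alpha>, of ?n] t by simp
  have tR: "t < R k" for k
  proof -
    have "(1::real) < 2 ^ (k + 1)" by (rule one_less_power) auto
    then show ?thesis using t by (simp add: R_def del: power_Suc)
  qed
  define \<rho> where "\<rho> = 2 powr (- \<alpha>)"
  have \<rho>: "0 < \<rho>" "\<rho> < 1" using \<alpha> by (auto simp: \<rho>_def powr_less_one)
  have summand: "a k * (?\<omega> * R k ^ ?n) = ?c * ?\<omega> * 2 ^ ?n * \<rho> ^ k" for k
  proof -
    have "(2 ^ k :: real) powr (- (real ?n + \<alpha>)) * (2 ^ k) ^ ?n = \<rho> ^ k"
      unfolding \<rho>_def
      by (simp add: powr_realpow[symmetric] powr_powr powr_add[symmetric] algebra_simps)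
    moreover have "R k ^ ?n = 2 ^ ?n * (2 ^ k) ^ ?n * t ^ ?n"
      by (simp add: R_def power_mult_distrib)
    ultimately show ?thesis unfolding a_def using t by (simp add: field_simps)
  qed
  have [measurable]: "ball x (R k) \<in> sets lebesgue" for k by simp
  have "(\<integral>\<^sup>+y. ennreal (cs_kernel \<alpha> t (x - y) * \<bar>f y\<bar>) \<partial>lebesgue)
      \<le> (\<integral>\<^sup>+y. (\<Sum>k. ennreal (a k) * (ennreal \<bar>f y\<bar> * indicator (ball x (R k)) y)) \<partial>lebesgue)"
  proof (rule nn_integral_mono)
    fix y
    obtain k where k: "norm (x - y) < 2 ^ (k + 1) * t"
      "cs_kernel \<alpha> t (x - y) \<le> ?c * (2 ^ k) powr (- (real ?n + \<alpha>)) / t ^ ?n"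
      using cs_kernel_le_dyadic[OF \<alpha> t] by blast
    have "ennreal (cs_kernel \<alpha> t (x - y) * \<bar>f y\<bar>) \<le> ennreal (a k * \<bar>f y\<bar>)"
      using k(2) unfolding a_def by (intro ennreal_leI mult_right_mono) auto
    also have "\<dots> = ennreal (a k) * (ennreal \<bar>f y\<bar> * indicator (ball x (R k)) y)"
      using k(1) a0[of k] by (simp add: R_def dist_norm ennreal_mult)
    also have "\<dots> \<le> (\<Sum>k. ennreal (a k) * (ennreal \<bar>f y\<bar> * indicator (ball x (R k)) y))"
      using sum_le_suminf[OF summableI, of "{k}" "\<lambda>k. ennreal (a k) * (ennreal \<bar>f y\<bar> * indicator (ball x (R k)) y)"]
      by simp
    finally show "ennreal (cs_kernel \<alpha> t (x - y) * \<bar>f y\<bar>)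
        \<le> (\<Sum>k. ennreal (a k) * (ennreal \<bar>f y\<bar> * indicator (ball x (R k)) y))" .
  qed
  also have "\<dots> = (\<Sum>k. ennreal (a k) * (\<integral>\<^sup>+y. ennreal \<bar>f y\<bar> * indicator (ball x (R k)) y \<partial>lebesgue))"
    by (subst nn_integral_suminf) (auto simp: nn_integral_cmult)
  also have "\<dots> \<le> (\<Sum>k. ennreal (a k) * (ennreal L * emeasure lebesgue (ball x (R k))))"
    by (intro suminf_le summableI mult_left_mono avg tR) auto
  also have "\<dots> = (\<Sum>k. ennreal (?c * ?\<omega> * 2 ^ ?n * L) * ennreal (\<rho> ^ k))"
  proof (rule suminf_cong)
    fix k
    have "ennreal (a k) * (ennreal L * emeasure lebesgue (ball x (R k))) = ennreal (L * (a k * (?\<omega> * R k ^ ?n)))"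
      using t tR[of k] L a0[of k]
      by (subst emeasure_lebesgue_ball) (auto simp: ennreal_mult[symmetric] mult_ac)
    also have "L * (a k * (?\<omega> * R k ^ ?n)) = ?c * ?\<omega> * 2 ^ ?n * L * \<rho> ^ k"
      unfolding summand by simp
    also have "ennreal \<dots> = ennreal (?c * ?\<omega> * 2 ^ ?n * L) * ennreal (\<rho> ^ k)"
      using \<rho> by (intro ennreal_mult'') simp
    finally show "ennreal (a k) * (ennreal L * emeasure lebesgue (ball x (R k)))
        = ennreal (?c * ?\<omega> * 2 ^ ?n * L) * ennreal (\<rho> ^ k)" .
  qed
  also have "\<dots> = ennreal (?c * ?\<omega> * 2 ^ ?n * L) * ennreal (1 / (1 - \<rho>))"
    using \<rho> by (simp add: suminf_ennreal_eq[OF _ geometric_sums] del: suminf_ennreal)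
  also have "\<dots> = ennreal (?c * ?\<omega> * 2 ^ ?n * L * (1 / (1 - \<rho>)))"
    using \<rho> by (intro ennreal_mult''[symmetric]) simp
  also have "?c * ?\<omega> * 2 ^ ?n * L * (1 / (1 - \<rho>)) = dyadic_const ?n \<alpha> * L"
    unfolding dyadic_const_def \<rho>_def by simp
  finally show ?thesis .
qed

text \<open>Where the integrand is not integrable the Bochner integral is 0, so the bound holds for
  every \<open>f\<close>.\<close>

lemma abs_cs_extension_le:
  "ennreal \<bar>cs_extension \<alpha> f (x, t)\<bar> \<le> (\<integral>\<^sup>+y. ennreal \<bar>cs_kernel \<alpha> t (x - y) * f y\<bar> \<partial>lebesgue)"
proof (cases "integrable lebesgue (\<lambda>y. cs_kernel \<alpha> t (x - y) * f y)")
  case True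
  from integral_norm_bound_ennreal[OF this] show ?thesis by (simp add: cs_extension_def)
next
  case False
  then show ?thesis by (simp add: cs_extension_def not_integrable_integral_eq)
qed

section \<open>A covering estimate comparing two measures\<close>

text \<open>The pieces \<open>s i\<close> live above the balls, and \<open>T j\<close> is an
  enlargement that swallows every piece whose ball lies in the fivefold dilate of ball
  \<open>j\<close>. The selected balls are disjoint, so their \<open>M\<close>-masses add up to at
  most that of \<open>U\<close>. It is applied to tents, with a weighted measure \<open>M\<close>,
  and to thin layers, with Lebesgue measure.\<close>

lemma vitali_cover_emeasure_le:
  fixes a :: "'i \<Rightarrow> 'b::euclidean_space" and b :: ennreal
  assumes r: "\<And>i. i \<in> K \<Longrightarrow> 0 < r i \<and> r i \<le> B"
    and sets: "\<And>i. i \<in> K \<Longrightarrow> T i \<in> sets \<mu>" "\<And>i. i \<in> K \<Longrightarrow> ball (a i) (r i) \<in> sets M" "U \<in> sets M"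
    and U: "\<And>i. i \<in> K \<Longrightarrow> ball (a i) (r i) \<subseteq> U"
    and cover: "S \<subseteq> (\<Union>i\<in>K. s i)"
    and T: "\<And>i j. i \<in> K \<Longrightarrow> j \<in> K \<Longrightarrow> dist (a i) (a j) + r i < 5 * r j \<Longrightarrow> s i \<subseteq> T j"
    and b: "\<And>i. i \<in> K \<Longrightarrow> emeasure \<mu> (T i) \<le> b * emeasure M (ball (a i) (r i))"
  shows "emeasure \<mu> S \<le> b * emeasure M U"
proof -
  obtain C where C: "countable C" "C \<subseteq> K"
    and disj: "pairwise (\<lambda>i j. disjnt (cball (a i) (r i)) (cball (a j) (r j))) C"
    and enl: "\<And>i. i \<in> K \<Longrightarrow> \<exists>j. j \<in> C \<and> \<not> disjnt (cball (a i) (r i)) (cball (a j) (r j))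
        \<and> cball (a i) (r i) \<subseteq> ball (a j) (5 * r j)"
    using Vitali_covering_lemma_cballs_balls[of K r B a] r by auto
  have "S \<subseteq> (\<Union>j\<in>C. T j)"
  proof
    fix z assume "z \<in> S"
    then obtain i where i: "i \<in> K" "z \<in> s i" using cover by blast
    then obtain j where j: "j \<in> C" "cball (a i) (r i) \<subseteq> ball (a j) (5 * r j)" using enl by blast
    \<comment> \<open>The radius of ball \<open>i\<close> is positive, so the inclusion of balls is
      equivalent to this inequality between numbers.\<close>
    have "dist (a i) (a j) + r i < 5 * r j"
      using j(2) r[OF i(1)] by (auto simp: cball_subset_ball_iff)
    then show "z \<in> (\<Union>j\<in>C. T j)" using T[of i j] i j(1) C(2) by blast
  qed
  moreover have "(\<Union>j\<in>C. T j) \<in> sets \<mu>" using C sets by (intro sets.countable_UN') auto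
  ultimately have "emeasure \<mu> S \<le> emeasure \<mu> (\<Union>j\<in>C. T j)" by (rule emeasure_mono)
  also have "\<dots> \<le> (\<integral>\<^sup>+j. emeasure \<mu> (T j) \<partial>count_space C)"
    using C sets by (intro emeasure_UN_le_nn_integral_count_space) auto
  also have "\<dots> \<le> (\<integral>\<^sup>+j. b * emeasure M (ball (a j) (r j)) \<partial>count_space C)"
    using C b by (intro nn_integral_mono) auto
  also have "\<dots> = b * (\<integral>\<^sup>+j. emeasure M (ball (a j) (r j)) \<partial>count_space C)"
    by (intro nn_integral_cmult) simp
  also have "(\<integral>\<^sup>+j. emeasure M (ball (a j) (r j)) \<partial>count_space C) = emeasure M (\<Union>j\<in>C. ball (a j) (r j))"
  proof (rule emeasure_UN_countable[symmetric])
    show "disjoint_family_on (\<lambda>j. ball (a j) (r j)) C"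
      unfolding disjoint_family_on_def
    proof (intro ballI impI)
      fix i j assume "i \<in> C" "j \<in> C" "i \<noteq> j"
      then have "disjnt (cball (a i) (r i)) (cball (a j) (r j))" using disj by (auto simp: pairwise_def)
      then show "ball (a i) (r i) \<inter> ball (a j) (r j) = {}"
        using ball_subset_cball[of "a i" "r i"] ball_subset_cball[of "a j" "r j"]
        unfolding disjnt_def by blast
    qed
  qed (use C sets in auto)
  also have "\<dots> \<le> emeasure M U" using C U sets by (intro emeasure_mono) auto
  finally show ?thesis by (simp add: mult_left_mono)
qed

section \<open>The Carleson embedding\<close>

text \<open>A cylinder rather than a cone, so that inclusion of tents reduces to inclusion of the
  base balls and comparison of the heights.\<close>

definition tent :: "real^'n \<Rightarrow> real \<Rightarrow> ((real^'n) \<times> real) set" where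
  "tent x R = ball x R \<times> {0<..<R}"

text \<open>\<open>s = 1\<close> is the classical Carleson condition. The base
  \<open>R ^ CARD('n)\<close> is the volume of the ball up to a constant, so it splits under
  \<open>powr\<close> as volumes do.\<close>

definition carleson :: "real \<Rightarrow> real \<Rightarrow> ((real^'n) \<times> real) measure \<Rightarrow> bool" where
  "carleson A s \<mu> \<longleftrightarrow>
     (\<forall>x R. 0 < R \<longrightarrow> emeasure \<mu> (tent x R) \<le> ennreal (A * (R ^ CARD('n)) powr s))"

lemma carlesonD:
  fixes \<mu> :: "((real^'n) \<times> real) measure"
  shows "carleson A s \<mu> \<Longrightarrow> 0 < R \<Longrightarrow> emeasure \<mu> (tent x R) \<le> ennreal (A * (R ^ CARD('n)) powr s)"
  unfolding carleson_def by blast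

lemma open_tent: "open (tent x R)"
  unfolding tent_def by (intro open_Times) auto

lemma tent_subset: "tent x R \<subseteq> upper_half_space"
  unfolding tent_def upper_half_space_def by auto

lemma sets_upper_half_space_borel:
  fixes \<mu> :: "((real^'n) \<times> real) measure"
  assumes "sets \<mu> = sets (restrict_space borel upper_half_space)" "U \<in> sets borel" "U \<subseteq> upper_half_space"
  shows "U \<in> sets \<mu>"
proof -
  have "open (upper_half_space :: ((real^'n) \<times> real) set)"
    unfolding upper_half_space_def by (intro open_Times) auto
  then have "(upper_half_space :: ((real^'n) \<times> real) set) \<inter> space borel \<in> sets borel" by auto
  then show ?thesis unfolding assms(1) using assms(2,3) by (subst sets_restrict_space_iff) auto
qed

lemma sets_upper_half_space_open:
  fixes \<mu> :: "((real^'n) \<times> real) measure"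
  assumes "sets \<mu> = sets (restrict_space borel upper_half_space)" "open U" "U \<subseteq> upper_half_space"
  shows "U \<in> sets \<mu>"
  by (rule sets_upper_half_space_borel[OF assms(1) borel_open[OF assms(2)] assms(3)])

definition big_balls :: "(real^'n \<Rightarrow> real) \<Rightarrow> real \<Rightarrow> ((real^'n) \<times> real) set" where
  "big_balls f L = {(x, R). 0 < R \<and>
     ennreal L * emeasure lebesgue (ball x R) < (\<integral>\<^sup>+y. ennreal \<bar>f y\<bar> * indicator (ball x R) y \<partial>lebesgue)}"

text \<open>For \<open>L\<close> at least 0 this is the superlevel set of the maximal function that
  assigns to (z, t), t > 0, the supremum of the averages of |f| over balls of radius larger than t
  containing z. As a union of open tents it is open, which settles measurability although the family
  is uncountable.\<close>

definition tent_union :: "(real^'n \<Rightarrow> real) \<Rightarrow> real \<Rightarrow> ((real^'n) \<times> real) set" where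
  "tent_union f L = (\<Union>(x, R)\<in>big_balls f L. tent x R)"

lemma open_tent_union: "open (tent_union f L)"
  unfolding tent_union_def by (intro open_UN) (auto simp: open_tent)

lemma tent_union_subset: "tent_union f L \<subseteq> upper_half_space"
  unfolding tent_union_def using tent_subset by blast

text \<open>If the average of $|f|$ over a ball exceeds $2L$, then the part of $f$ above height $L$ already
  has average at least $L$ there. Working with that part only is what makes the sum over the levels
  $L$ converge to an $L^p$ norm in \<open>sum_levels_le\<close>.\<close>

lemma emeasure_tent_union_le:
  fixes f :: "real^'n \<Rightarrow> real" and \<mu> :: "((real^'n) \<times> real) measure"
  assumes sets: "sets \<mu> = sets (restrict_space borel upper_half_space)"
    and car: "carleson A s \<mu>" and A: "0 \<le> A" and s: "1 \<le> s"
    and f[measurable]: "f \<in> borel_measurable lebesgue" and L: "0 < L" and h: "0 \<le> h"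
    and top_bound: "(\<integral>\<^sup>+y. ennreal \<bar>f y\<bar> * indicator {y. L < \<bar>f y\<bar>} y \<partial>lebesgue)
       \<le> ennreal (L * (unit_ball_vol (real CARD('n)) * h))"
  shows "emeasure \<mu> (tent_union f (2 * L))
    \<le> ennreal (A * (5 ^ CARD('n)) powr s * h powr (s - 1) / (L * unit_ball_vol (real CARD('n))))
       * (\<integral>\<^sup>+y. ennreal \<bar>f y\<bar> * indicator {y. L < \<bar>f y\<bar>} y \<partial>lebesgue)"
proof -
  let ?n = "CARD('n)" and ?\<omega> = "unit_ball_vol (real CARD('n))"
  have \<omega>: "0 < ?\<omega>" by simp
  define F where "F y = ennreal \<bar>f y\<bar> * indicator {y. L < \<bar>f y\<bar>} y" for y
  have [measurable]: "F \<in> borel_measurable lebesgue" unfolding F_def by measurable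
  \<comment> \<open>The mass of the truncated function is the base measure for the covering lemma,
    so the disjoint balls together contribute at most the integral of \<open>F\<close>.\<close>
  define \<nu> where "\<nu> = density lebesgue F"
  have sets_\<nu>: "sets \<nu> = sets lebesgue" by (simp add: \<nu>_def)
  have \<nu>: "emeasure \<nu> X = (\<integral>\<^sup>+y. F y * indicator X y \<partial>lebesgue)" if "X \<in> sets lebesgue" for X
    unfolding \<nu>_def using that by (intro emeasure_density) auto
  have \<nu>_UNIV: "emeasure \<nu> UNIV = (\<integral>\<^sup>+y. F y \<partial>lebesgue)" using \<nu>[of UNIV] by simp
  have key: "ennreal (L * (?\<omega> * R ^ ?n)) \<le> emeasure \<nu> (ball x R)"
    if "(x, R) \<in> big_balls f (2 * L)" for x R
  proof (rule ccontr)
    assume neg: "\<not> ?thesis"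
    have R: "0 < R" and big: "ennreal (2 * L) * emeasure lebesgue (ball x R)
        < (\<integral>\<^sup>+y. ennreal \<bar>f y\<bar> * indicator (ball x R) y \<partial>lebesgue)"
      using that by (auto simp: big_balls_def)
    have v: "0 \<le> L * (?\<omega> * R ^ ?n)" using L R by simp
    have [measurable]: "ball x R \<in> sets lebesgue" by simp
    have "(\<integral>\<^sup>+y. ennreal \<bar>f y\<bar> * indicator (ball x R) y \<partial>lebesgue)
        \<le> (\<integral>\<^sup>+y. ennreal L * indicator (ball x R) y + F y * indicator (ball x R) y \<partial>lebesgue)"
      by (intro nn_integral_mono) (auto simp: F_def indicator_def intro: ennreal_leI)
    also have "\<dots> = ennreal L * emeasure lebesgue (ball x R) + emeasure \<nu> (ball x R)"
      by (subst nn_integral_add) (auto simp: nn_integral_cmult_indicator \<nu>)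
    also have "ennreal L * emeasure lebesgue (ball x R) = ennreal (L * (?\<omega> * R ^ ?n))"
      using L R by (subst emeasure_lebesgue_ball) (auto simp: ennreal_mult')
    also have "ennreal (L * (?\<omega> * R ^ ?n)) + emeasure \<nu> (ball x R)
        \<le> ennreal (L * (?\<omega> * R ^ ?n)) + ennreal (L * (?\<omega> * R ^ ?n))"
      using neg by (intro add_left_mono) simp
    also have "\<dots> = ennreal (2 * L) * emeasure lebesgue (ball x R)"
      using L R v by (subst emeasure_lebesgue_ball)
        (auto simp: ennreal_mult'[symmetric] ennreal_plus[symmetric] simp del: ennreal_plus)
    finally show False using big by simp
  qed
  \<comment> \<open>The total mass of \<open>\<nu>\<close> limits, through \<open>key\<close>, the
    volume of each ball with a large average. This supplies both the radius bound for the Vitali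
    lemma and the uniform factor \<open>h powr (s - 1)\<close>.\<close>
  have Rn: "R ^ ?n \<le> h" if "(x, R) \<in> big_balls f (2 * L)" for x R
  proof -
    have "0 < R" using that by (simp add: big_balls_def)
    have "ennreal (L * (?\<omega> * R ^ ?n)) \<le> emeasure \<nu> UNIV"
      using key[OF that] by (rule order_trans) (intro emeasure_mono; simp add: sets_\<nu>)
    also have "\<dots> \<le> ennreal (L * (?\<omega> * h))" using top_bound unfolding \<nu>_UNIV F_def .
    finally have "L * (?\<omega> * R ^ ?n) \<le> L * (?\<omega> * h)" using L h \<omega> by (simp add: ennreal_le_iff)
    then show ?thesis using L \<omega> by simp
  qed
  have "emeasure \<mu> (tent_union f (2 * L))
      \<le> ennreal (A * (5 ^ ?n) powr s * h powr (s - 1) / (L * ?\<omega>)) * emeasure \<nu> UNIV"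
  proof (rule vitali_cover_emeasure_le[where K = "big_balls f (2 * L)" and a = fst and r = snd
        and B = "1 + h" and T = "\<lambda>(x, R). tent x (5 * R)" and s = "\<lambda>(x, R). tent x R"], goal_cases)
    case (1 i)
    obtain x R where i: "i = (x, R)" by force
    have "0 < R" using 1 by (simp add: i big_balls_def)
    \<comment> \<open>Only a power of R is bounded by \<open>h\<close>; a radius above 1 is at most
      its own power, and the remaining radii are at most 1.\<close>
    moreover have "R \<le> 1 + h"
    proof (cases "R \<le> 1")
      case False
      then have "R \<le> R ^ ?n" by (intro self_le_power) auto
      with Rn[of x R] 1 show ?thesis by (simp add: i)
    qed (use h in simp)
    ultimately show ?case by (simp add: i)
  next
    case (2 i)
    show ?case using sets_upper_half_space_open[OF sets open_tent tent_subset] by (cases i) simp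
  next
    case (7 i j)
    obtain x R where i: "i = (x, R)" by force
    obtain y R' where j: "j = (y, R')" by force
    have *: "dist x y + R < 5 * R'" using 7(3) by (simp add: i j)
    have "z \<in> ball y (5 * R') \<and> u < 5 * R'" if "dist x z < R" "u < R" for z u
    proof -
      have "dist y z < 5 * R'" using * that dist_triangle3[of y z x] by linarith
      moreover have "u < 5 * R'" using * that zero_le_dist[of x y] by linarith
      ultimately show ?thesis by simp
    qed
    then show ?case unfolding i j by (auto simp: tent_def)
  next
    case (8 i)
    obtain x R where i: "i = (x, R)" by force
    have R: "0 < R" using 8 by (simp add: i big_balls_def)
    have "emeasure \<mu> (tent x (5 * R)) \<le> ennreal (A * ((5 * R) ^ ?n) powr s)"
      using R by (intro carlesonD[OF car]) simp
    also have "\<dots> \<le> ennreal (A * (5 ^ ?n) powr s * h powr (s - 1) / (L * ?\<omega>) * (L * (?\<omega> * R ^ ?n)))"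
    proof (rule ennreal_leI)
      have "((5 * R) ^ ?n) powr s = (5 ^ ?n) powr s * ((R ^ ?n) powr (s - 1) * R ^ ?n)"
        using R by (simp add: power_mult_distrib powr_mult powr_diff)
      also have "\<dots> \<le> (5 ^ ?n) powr s * (h powr (s - 1) * R ^ ?n)"
        using R Rn[of x R] 8 s by (intro mult_left_mono mult_right_mono powr_mono2) (auto simp: i)
      finally have "A * ((5 * R) ^ ?n) powr s \<le> A * ((5 ^ ?n) powr s * (h powr (s - 1) * R ^ ?n))"
        using A by (rule mult_left_mono)
      also have "\<dots> = A * (5 ^ ?n) powr s * h powr (s - 1) / (L * ?\<omega>) * (L * (?\<omega> * R ^ ?n))"
        using L \<omega> by (simp add: field_simps)
      finally show "A * ((5 * R) ^ ?n) powr s \<le> \<dots>" .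
    qed
    also have "\<dots> = ennreal (A * (5 ^ ?n) powr s * h powr (s - 1) / (L * ?\<omega>)) * ennreal (L * (?\<omega> * R ^ ?n))"
      using A L \<omega> by (intro ennreal_mult') simp
    also have "\<dots> \<le> ennreal (A * (5 ^ ?n) powr s * h powr (s - 1) / (L * ?\<omega>)) * emeasure \<nu> (ball x R)"
      using key[of x R] 8 by (intro mult_left_mono) (auto simp: i)
    finally show ?case by (simp add: i)
  qed (auto simp: sets_\<nu> tent_union_def)
  then show ?thesis unfolding \<nu>_UNIV F_def .
qed

section \<open>Summation over dyadic levels\<close>

text \<open>Where |f| exceeds L, the factor |f|^(1-p) is at most L^(1-p), since the exponent is not
  positive; multiply by |f|^p.\<close>

lemma nn_integral_above_level_le:
  fixes f :: "'a \<Rightarrow> real"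
  assumes f[measurable]: "f \<in> borel_measurable M" and L: "0 < L" and p: "1 \<le> p"
    and N: "(\<integral>\<^sup>+y. ennreal (\<bar>f y\<bar> powr p) \<partial>M) \<le> ennreal N"
  shows "(\<integral>\<^sup>+y. ennreal \<bar>f y\<bar> * indicator {y. L < \<bar>f y\<bar>} y \<partial>M) \<le> ennreal (L powr (1 - p) * N)"
proof -
  have "(\<integral>\<^sup>+y. ennreal \<bar>f y\<bar> * indicator {y. L < \<bar>f y\<bar>} y \<partial>M)
      \<le> (\<integral>\<^sup>+y. ennreal (L powr (1 - p)) * ennreal (\<bar>f y\<bar> powr p) \<partial>M)"
  proof (rule nn_integral_mono)
    fix y
    show "ennreal \<bar>f y\<bar> * indicator {y. L < \<bar>f y\<bar>} y \<le> ennreal (L powr (1 - p)) * ennreal (\<bar>f y\<bar> powr p)"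
    proof (cases "L < \<bar>f y\<bar>")
      case True
      then have "\<bar>f y\<bar> powr (1 - p) * \<bar>f y\<bar> powr p \<le> L powr (1 - p) * \<bar>f y\<bar> powr p"
        using L p by (intro mult_right_mono powr_mono2') auto
      moreover have "\<bar>f y\<bar> powr (1 - p) * \<bar>f y\<bar> powr p = \<bar>f y\<bar>"
        by (simp flip: powr_add)
      ultimately show ?thesis using True by (simp flip: ennreal_mult')
    qed simp
  qed
  also have "\<dots> = ennreal (L powr (1 - p)) * (\<integral>\<^sup>+y. ennreal (\<bar>f y\<bar> powr p) \<partial>M)"
    by (rule nn_integral_cmult) measurable
  also have "\<dots> \<le> ennreal (L powr (1 - p)) * ennreal N" using N by (rule mult_left_mono) simp
  finally show ?thesis by (simp add: ennreal_mult')
qed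

text \<open>A dyadic layer-cake argument: after exchanging sum and integral, the levels below 2|f y|
  sum geometrically to a multiple of |f y|^(p-1), and the remaining factor |f y| completes the p-th
  power.\<close>

lemma sum_levels_le:
  fixes f :: "'a \<Rightarrow> real"
  assumes f[measurable]: "f \<in> borel_measurable M" and p: "1 < p"
  shows "(\<integral>\<^sup>+j. ennreal (2 powr (of_int j * (p - 1))) *
            (\<integral>\<^sup>+y. ennreal \<bar>f y\<bar> * indicator {y. 2 powr (of_int j - 1) < \<bar>f y\<bar>} y \<partial>M) \<partial>count_space (UNIV :: int set))
      \<le> ennreal (2 powr (p - 1) / (1 - 2 powr (1 - p))) * (\<integral>\<^sup>+y. ennreal (\<bar>f y\<bar> powr p) \<partial>M)"
    (is "?lhs \<le> ennreal ?c * _")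
proof -
  have "2 powr (1 - p) < 1" using p by (simp add: powr_less_one)
  then have c: "0 \<le> ?c" by (intro divide_nonneg_nonneg) auto
  have "?lhs = (\<integral>\<^sup>+j. (\<integral>\<^sup>+y. ennreal \<bar>f y\<bar> * (ennreal (2 powr (of_int j * (p - 1))) *
           indicator {j. 2 powr (of_int j - 1) < \<bar>f y\<bar>} j) \<partial>M) \<partial>count_space (UNIV :: int set))"
    by (subst nn_integral_cmult[symmetric], measurable)
       (intro nn_integral_cong, auto simp: indicator_def mult.commute)
  also have "\<dots> = (\<integral>\<^sup>+y. (\<integral>\<^sup>+j. ennreal \<bar>f y\<bar> * (ennreal (2 powr (of_int j * (p - 1))) *
           indicator {j. 2 powr (of_int j - 1) < \<bar>f y\<bar>} j) \<partial>count_space (UNIV :: int set)) \<partial>M)"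
  proof (rule nn_integral_count_space_nn_integral[symmetric])
    fix j :: int
    have "(\<lambda>y. ennreal \<bar>f y\<bar> * (ennreal (2 powr (of_int j * (p - 1))) *
           indicator {y. 2 powr (of_int j - 1) < \<bar>f y\<bar>} y)) \<in> borel_measurable M"
      by measurable
    then show "(\<lambda>y. ennreal \<bar>f y\<bar> * (ennreal (2 powr (of_int j * (p - 1))) *
           indicator {j. 2 powr (of_int j - 1) < \<bar>f y\<bar>} j)) \<in> borel_measurable M"
      by (simp add: indicator_def)
  qed simp
  also have "\<dots> \<le> (\<integral>\<^sup>+y. ennreal ?c * ennreal (\<bar>f y\<bar> powr p) \<partial>M)"
  proof (rule nn_integral_mono)
    fix y
    have "(\<integral>\<^sup>+j. ennreal \<bar>f y\<bar> * (ennreal (2 powr (of_int j * (p - 1))) *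
           indicator {j. 2 powr (of_int j - 1) < \<bar>f y\<bar>} j) \<partial>count_space (UNIV :: int set))
       = ennreal \<bar>f y\<bar> * (\<integral>\<^sup>+j. ennreal (2 powr (of_int j * (p - 1))) *
           indicator {j. 2 powr (of_int j - 1) < \<bar>f y\<bar>} j \<partial>count_space (UNIV :: int set))"
      by (rule nn_integral_cmult) simp
    also have "\<dots> \<le> ennreal \<bar>f y\<bar> * ennreal (2 powr (p - 1) / (1 - 2 powr (- (p - 1))) * \<bar>f y\<bar> powr (p - 1))"
      using p by (intro mult_left_mono geometric_sum_int_le) auto
    also have "\<dots> = ennreal (\<bar>f y\<bar> * (?c * \<bar>f y\<bar> powr (p - 1)))"
      by (subst ennreal_mult'[symmetric]) simp_all
    also have "\<bar>f y\<bar> * (?c * \<bar>f y\<bar> powr (p - 1)) = ?c * \<bar>f y\<bar> powr p"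
    proof -
      have "\<bar>f y\<bar> * \<bar>f y\<bar> powr (p - 1) = \<bar>f y\<bar> powr p" by (simp add: powr_mult_base)
      then show ?thesis by (subst mult.left_commute) (simp only:)
    qed
    also have "ennreal \<dots> = ennreal ?c * ennreal (\<bar>f y\<bar> powr p)"
      using c by (rule ennreal_mult')
    finally show "(\<integral>\<^sup>+j. ennreal \<bar>f y\<bar> * (ennreal (2 powr (of_int j * (p - 1))) *
           indicator {j. 2 powr (of_int j - 1) < \<bar>f y\<bar>} j) \<partial>count_space (UNIV :: int set))
        \<le> ennreal ?c * ennreal (\<bar>f y\<bar> powr p)" .
  qed
  also have "\<dots> = ennreal ?c * (\<integral>\<^sup>+y. ennreal (\<bar>f y\<bar> powr p) \<partial>M)"
    by (rule nn_integral_cmult) measurable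
  finally show ?thesis .
qed

text \<open>The point (x, t) lies in \<open>tent x R\<close> for every R > t. Outside
  \<open>tent_union f L\<close> all averages over balls centred at x of radius above t are therefore
  at most L.\<close>

lemma abs_cs_extension_le_level:
  fixes f :: "real^'n \<Rightarrow> real"
  assumes \<alpha>: "0 < \<alpha>" and t: "0 < t" and f[measurable]: "f \<in> borel_measurable lebesgue" and L: "0 \<le> L"
    and notin: "(x, t) \<notin> tent_union f L"
  shows "\<bar>cs_extension \<alpha> f (x, t)\<bar> \<le> dyadic_const CARD('n) \<alpha> * L"
proof -
  have "ennreal \<bar>cs_extension \<alpha> f (x, t)\<bar> \<le> (\<integral>\<^sup>+y. ennreal \<bar>cs_kernel \<alpha> t (x - y) * f y\<bar> \<partial>lebesgue)"
    by (rule abs_cs_extension_le)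
  also have "\<dots> = (\<integral>\<^sup>+y. ennreal (cs_kernel \<alpha> t (x - y) * \<bar>f y\<bar>) \<partial>lebesgue)"
    by (simp add: abs_mult abs_of_nonneg[OF cs_kernel_nonneg[OF \<alpha>]])
  also have "\<dots> \<le> ennreal (dyadic_const CARD('n) \<alpha> * L)"
  proof (rule nn_integral_cs_kernel_le[OF \<alpha> t f L])
    fix R assume R: "t < R"
    then have "(x, t) \<in> tent x R" using t by (simp add: tent_def)
    then have "(x, R) \<notin> big_balls f L" using notin by (auto simp: tent_union_def)
    then show "(\<integral>\<^sup>+y. ennreal \<bar>f y\<bar> * indicator (ball x R) y \<partial>lebesgue)
        \<le> ennreal L * emeasure lebesgue (ball x R)"
      using R t by (simp add: big_balls_def not_less)
  qed
  finally show ?thesis using dyadic_const_pos[OF \<alpha>, of "CARD('n)"] L by (simp add: ennreal_le_iff)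
qed

lemma cs_extension_powr_le:
  fixes f :: "real^'n \<Rightarrow> real"
  assumes \<alpha>: "0 < \<alpha>" and q: "0 < q" and t: "0 < t" and f: "f \<in> borel_measurable lebesgue"
  shows "ennreal (\<bar>cs_extension \<alpha> f (x, t)\<bar> powr q)
    \<le> (\<integral>\<^sup>+j. ennreal ((2 * dyadic_const CARD('n) \<alpha> * 2 powr (of_int j)) powr q) *
           indicator (tent_union f (2 powr (of_int j))) (x, t) \<partial>count_space (UNIV :: int set))"
proof -
  define v where "v = \<bar>cs_extension \<alpha> f (x, t)\<bar>"
  let ?D = "dyadic_const CARD('n) \<alpha>"
  let ?F = "\<lambda>j. ennreal ((2 * ?D * 2 powr (of_int j)) powr q) *
           indicator (tent_union f (2 powr (of_int j))) (x, t)"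
  have D: "0 < ?D" using \<alpha> by (rule dyadic_const_pos)
  show ?thesis
  proof (cases "v = 0")
    case True
    then show ?thesis by (simp add: v_def)
  next
    case False
    then have v: "0 < v" by (simp add: v_def)
    \<comment> \<open>Ceiling minus 1, not floor: the lower inequality for \<open>v\<close> must be
      strict to contradict \<open>abs_cs_extension_le_level\<close>, while the upper one need not
      be.\<close>
    define j where "j = \<lceil>log 2 (v / ?D)\<rceil> - 1"
    have j: "real_of_int j < log 2 (v / ?D)" "log 2 (v / ?D) \<le> real_of_int j + 1"
      unfolding j_def by linarith+
    have "2 powr real_of_int j < v / ?D" using j(1) v D by (simp add: less_log_iff)
    then have lower: "?D * 2 powr real_of_int j < v" using D by (simp add: field_simps)
    have "v / ?D \<le> 2 powr (real_of_int j + 1)" using j(2) v D by (simp add: log_le_iff)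
    then have upper: "v \<le> 2 * ?D * 2 powr real_of_int j" using D by (simp add: field_simps powr_add)
    have "(x, t) \<in> tent_union f (2 powr real_of_int j)"
      using abs_cs_extension_le_level[OF \<alpha> t f, of "2 powr real_of_int j" x] lower
      by (force simp: v_def)
    moreover have "v powr q \<le> (2 * ?D * 2 powr real_of_int j) powr q"
      using upper v q by (intro powr_mono2) auto
    ultimately have "ennreal (v powr q) \<le> ?F j" by (simp add: ennreal_leI)
    also have "\<dots> \<le> (\<integral>\<^sup>+j. ?F j \<partial>count_space UNIV)" by (rule nn_integral_ge_point) simp
    finally show ?thesis unfolding v_def .
  qed
qed

text \<open>\<open>N\<close> is any positive upper bound rather than the integral itself: for \<open>s = 1\<close> and \<open>f = 0\<close> the proof
  would otherwise meet the junk value \<open>0 powr 0 = 0\<close>.\<close>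

lemma nn_integral_cs_extension_le:
  fixes \<mu> :: "((real^'n) \<times> real) measure"
  assumes sets: "sets \<mu> = sets (restrict_space borel upper_half_space)"
    and car: "carleson A s \<mu>" and A: "0 \<le> A" and s: "1 \<le> s" and p: "1 < p" and \<alpha>: "0 < \<alpha>"
  obtains C where "0 \<le> C"
    "\<And>f N. f \<in> borel_measurable lebesgue \<Longrightarrow> 0 < N \<Longrightarrow>
       (\<integral>\<^sup>+y. ennreal (\<bar>f y\<bar> powr p) \<partial>lebesgue) \<le> ennreal N \<Longrightarrow>
       (\<integral>\<^sup>+z. ennreal (\<bar>cs_extension \<alpha> f z\<bar> powr (p * s)) \<partial>\<mu>) \<le> ennreal (C * N powr s)"
proof -
  let ?n = "CARD('n)" and ?\<omega> = "unit_ball_vol (real CARD('n))" and ?D = "dyadic_const CARD('n) \<alpha>"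
  define c where "c = 2 powr (p - 1) / (1 - 2 powr (1 - p))"
  \<comment> \<open>The first factor comes from \<open>2 * ?D * (2 * L) = 4 * ?D * L\<close>, the
    second from the covering estimate, the last from rewriting L = 2^(j-1) in terms of 2^j.\<close>
  define B where "B = (4 * ?D) powr (p * s) * (A * (5 ^ ?n) powr s / ?\<omega> powr s) * 2 powr (1 - p)"
  have \<omega>: "0 < ?\<omega>" by simp
  have D: "0 < ?D" using \<alpha> by (rule dyadic_const_pos)
  have "2 powr (1 - p) < 1" using p by (simp add: powr_less_one)
  then have c: "0 \<le> c" unfolding c_def by (intro divide_nonneg_nonneg) auto
  have B: "0 \<le> B" using A D unfolding B_def by simp
  have space: "space \<mu> = upper_half_space" using sets_eq_imp_space_eq[OF sets] by (simp add: space_restrict_space)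
  have "(\<integral>\<^sup>+z. ennreal (\<bar>cs_extension \<alpha> f z\<bar> powr (p * s)) \<partial>\<mu>) \<le> ennreal (B * c * N powr s)"
    if f: "f \<in> borel_measurable lebesgue" and N: "0 < N"
      and fN: "(\<integral>\<^sup>+y. ennreal (\<bar>f y\<bar> powr p) \<partial>lebesgue) \<le> ennreal N" for f N
  proof -
    define G where "G j = (\<integral>\<^sup>+y. ennreal \<bar>f y\<bar> * indicator {y. 2 powr (of_int j - 1) < \<bar>f y\<bar>} y \<partial>lebesgue)"
      for j :: int
    have E[measurable]: "tent_union f L \<in> sets \<mu>" for L
      by (rule sets_upper_half_space_open[OF sets open_tent_union tent_union_subset])
    have level: "ennreal ((2 * ?D * 2 powr (of_int j)) powr (p * s)) * emeasure \<mu> (tent_union f (2 powr (of_int j)))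
        \<le> ennreal (B * N powr (s - 1)) * (ennreal (2 powr (of_int j * (p - 1))) * G j)" for j :: int
    proof -
      \<comment> \<open>The covering estimate at level 2 L = 2^j truncates \<open>f\<close> at L,
        whence the exponent j - 1 in \<open>G j\<close>.\<close>
      define L where "L = 2 powr (real_of_int j - 1)"
      have L: "0 < L" by (simp add: L_def)
      have L2: "2 powr real_of_int j = 2 * L" by (simp add: L_def powr_diff)
      \<comment> \<open>Solves \<open>L powr (1 - p) * N = L * (?\<omega> * h)\<close>, the form in
        which the covering estimate takes the bound on the truncated mass.\<close>
      define h where "h = L powr (- p) * N / ?\<omega>"
      have h: "0 \<le> h" using N \<omega> by (simp add: h_def)
      have "G j \<le> ennreal (L powr (1 - p) * N)"
        unfolding G_def L_def[symmetric] using f L p fN by (intro nn_integral_above_level_le) auto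
      also have "L powr (1 - p) * N = L * (?\<omega> * h)"
        using \<omega> L by (simp add: h_def powr_diff powr_minus field_simps)
      finally have *: "emeasure \<mu> (tent_union f (2 * L))
          \<le> ennreal (A * (5 ^ ?n) powr s * h powr (s - 1) / (L * ?\<omega>)) * G j"
        unfolding G_def L_def[symmetric]
        by (intro emeasure_tent_union_le sets car A s f L h)
      \<comment> \<open>The exponents of L add up to p*s - p*(s-1) - 1 = p - 1, the weight in
        \<open>sum_levels_le\<close>. The factor N^(s-1) left over combines with the integral of
        |f|^p to N^s.\<close>
      have "(2 * ?D * (2 * L)) powr (p * s) * (A * (5 ^ ?n) powr s * h powr (s - 1) / (L * ?\<omega>))
          = B * N powr (s - 1) * 2 powr (of_int j * (p - 1))"
      proof -
        have "2 * ?D * (2 * L) = 4 * ?D * L" by simp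
        then have 1: "(2 * ?D * (2 * L)) powr (p * s) = (4 * ?D) powr (p * s) * L powr (p * s)"
          by (simp only: powr_mult)
        have 2: "h powr (s - 1) = L powr (- (p * (s - 1))) * N powr (s - 1) / ?\<omega> powr (s - 1)"
          by (simp add: h_def powr_mult powr_divide powr_powr)
        have 3: "?\<omega> powr s = ?\<omega> powr (s - 1) * ?\<omega>" using \<omega> by (simp add: powr_diff)
        have "p * s + - (p * (s - 1)) = p" by (simp add: algebra_simps)
        then have "L powr (p * s) * L powr (- (p * (s - 1))) = L powr p"
          by (simp only: powr_add[symmetric])
        then have "L powr (p * s) * L powr (- (p * (s - 1))) / L = L powr (p - 1)"
          using L by (simp add: powr_diff)
        also have "L powr (p - 1) = 2 powr (1 - p) * 2 powr (of_int j * (p - 1))"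
        proof -
          have "(real_of_int j - 1) * (p - 1) = (1 - p) + of_int j * (p - 1)" by (simp add: algebra_simps)
          then show ?thesis unfolding L_def powr_powr by (simp only: powr_add)
        qed
        finally have 4: "L powr (p * s) * L powr (- (p * (s - 1))) / L
          = 2 powr (1 - p) * 2 powr (of_int j * (p - 1))" .
        have "(2 * ?D * (2 * L)) powr (p * s) * (A * (5 ^ ?n) powr s * h powr (s - 1) / (L * ?\<omega>))
          = (4 * ?D) powr (p * s) * (A * (5 ^ ?n) powr s / ?\<omega> powr s) * N powr (s - 1)
            * (L powr (p * s) * L powr (- (p * (s - 1))) / L)"
          unfolding 1 2 3 by (simp only: times_divide_eq_left times_divide_eq_right divide_divide_eq_left mult_ac)
        then show ?thesis unfolding 4 B_def by (simp only: mult_ac)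
      qed
      then have "ennreal ((2 * ?D * (2 * L)) powr (p * s)) * (ennreal (A * (5 ^ ?n) powr s * h powr (s - 1) / (L * ?\<omega>)) * G j)
         = ennreal (B * N powr (s - 1)) * (ennreal (2 powr (of_int j * (p - 1))) * G j)"
        using A L \<omega> B by (simp add: ennreal_mult[symmetric] mult.assoc[symmetric])
      moreover have "ennreal ((2 * ?D * (2 * L)) powr (p * s)) * emeasure \<mu> (tent_union f (2 * L))
         \<le> ennreal ((2 * ?D * (2 * L)) powr (p * s)) * (ennreal (A * (5 ^ ?n) powr s * h powr (s - 1) / (L * ?\<omega>)) * G j)"
        using * by (rule mult_left_mono) simp
      ultimately show ?thesis unfolding L2 by simp
    qed
    have "(\<integral>\<^sup>+z. ennreal (\<bar>cs_extension \<alpha> f z\<bar> powr (p * s)) \<partial>\<mu>)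
        \<le> (\<integral>\<^sup>+z. (\<integral>\<^sup>+j. ennreal ((2 * ?D * 2 powr (of_int j)) powr (p * s)) *
           indicator (tent_union f (2 powr (of_int j))) z \<partial>count_space (UNIV :: int set)) \<partial>\<mu>)"
    proof (rule nn_integral_mono)
      fix z assume "z \<in> space \<mu>"
      then obtain x t where "z = (x, t)" "0 < t" by (auto simp: space upper_half_space_def)
      then show "ennreal (\<bar>cs_extension \<alpha> f z\<bar> powr (p * s))
        \<le> (\<integral>\<^sup>+j. ennreal ((2 * ?D * 2 powr (of_int j)) powr (p * s)) *
           indicator (tent_union f (2 powr (of_int j))) z \<partial>count_space (UNIV :: int set))"
        using cs_extension_powr_le[OF \<alpha> _ _ f, of "p * s" t x] p s by simp
    qed
    also have "\<dots> = (\<integral>\<^sup>+j. ennreal ((2 * ?D * 2 powr (of_int j)) powr (p * s)) *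
           emeasure \<mu> (tent_union f (2 powr (of_int j))) \<partial>count_space (UNIV :: int set))"
      by (subst nn_integral_count_space_nn_integral) (auto simp: nn_integral_cmult_indicator)
    also have "\<dots> \<le> (\<integral>\<^sup>+j. ennreal (B * N powr (s - 1)) * (ennreal (2 powr (of_int j * (p - 1))) * G j)
        \<partial>count_space (UNIV :: int set))"
      by (rule nn_integral_mono) (rule level)
    also have "\<dots> = ennreal (B * N powr (s - 1)) *
        (\<integral>\<^sup>+j. ennreal (2 powr (of_int j * (p - 1))) * G j \<partial>count_space (UNIV :: int set))"
      by (rule nn_integral_cmult) simp
    also have "\<dots> \<le> ennreal (B * N powr (s - 1)) * (ennreal c * (\<integral>\<^sup>+y. ennreal (\<bar>f y\<bar> powr p) \<partial>lebesgue))"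
      unfolding G_def c_def by (intro mult_left_mono sum_levels_le f p) simp
    also have "\<dots> \<le> ennreal (B * N powr (s - 1)) * (ennreal c * ennreal N)"
      using fN by (intro mult_left_mono) auto
    also have "\<dots> = ennreal (B * c * N powr s)"
      using B c N by (simp add: ennreal_mult[symmetric] powr_diff)
    finally show ?thesis .
  qed
  moreover have "0 \<le> B * c" using B c by simp
  ultimately show ?thesis using that by blast
qed

lemma ennreal_powr_le:
  assumes "a \<le> ennreal b" "0 \<le> b" "0 \<le> e"
  shows "ennreal_powr a e \<le> ennreal (b powr e)"
proof -
  have "a \<noteq> top" using assms(1) by (auto simp: top_unique)
  moreover have "enn2real a \<le> b" using assms(1,2) enn2real_mono[of a "ennreal b"] by simp
  ultimately show ?thesis unfolding ennreal_powr_def using assms(3)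
    by (auto intro!: ennreal_leI powr_mono2)
qed

lemma carleson_imp_cs_embedding:
  fixes \<mu> :: "((real^'n) \<times> real) measure"
  assumes sets: "sets \<mu> = sets (restrict_space borel upper_half_space)"
    and car: "carleson A (q / p) \<mu>" and A: "0 \<le> A" and p: "1 < p" and pq: "p \<le> q" and \<alpha>: "0 < \<alpha>"
  shows "cs_embedding \<alpha> p q \<mu>"
proof -
  have s: "1 \<le> q / p" using p pq by simp
  have q: "p * (q / p) = q" using p by simp
  obtain C where C: "0 \<le> C"
    and bound: "\<And>f N. f \<in> borel_measurable lebesgue \<Longrightarrow> 0 < N \<Longrightarrow>
       (\<integral>\<^sup>+y. ennreal (\<bar>f y\<bar> powr p) \<partial>lebesgue) \<le> ennreal N \<Longrightarrow>
       (\<integral>\<^sup>+z. ennreal (\<bar>cs_extension \<alpha> f z\<bar> powr q) \<partial>\<mu>) \<le> ennreal (C * N powr (q / p))"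
    using nn_integral_cs_extension_le[OF sets car A s p \<alpha>] unfolding q by blast
  have "Lp_norm \<mu> q (cs_extension \<alpha> f) \<le> ennreal (C powr (1 / q)) * Lp_norm lebesgue p f"
    if "f \<in> Lp_space lebesgue p" for f
  proof -
    define I where "I = (\<integral>\<^sup>+z. ennreal (\<bar>cs_extension \<alpha> f z\<bar> powr q) \<partial>\<mu>)"
    define J where "J = (\<integral>\<^sup>+y. ennreal (\<bar>f y\<bar> powr p) \<partial>lebesgue)"
    have f: "f \<in> borel_measurable lebesgue" and "ennreal_powr J (1 / p) < top"
      using that by (auto simp: Lp_space_def Lp_norm_def J_def)
    then have "J \<noteq> top" by (auto simp: ennreal_powr_def)
    then obtain N where N: "J = ennreal N" "0 \<le> N" by (cases J) auto
    have I: "I \<le> ennreal (C * N powr (q / p))"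
    proof (cases "N = 0")
      case False
      then show ?thesis using bound[OF f, of N] N unfolding I_def J_def by simp
    next
      case True
      \<comment> \<open>The integral of |f|^p vanishes here, so \<open>bound\<close> applies with
        every positive N. The choice N = \<epsilon>^(p/q) leaves C \<epsilon>; below, \<epsilon> is
        taken with denominator C + 1 because C may be 0.\<close>
      have le: "I \<le> ennreal (C * \<epsilon>)" if "0 < \<epsilon>" for \<epsilon>
        using bound[OF f, of "\<epsilon> powr (p / q)"] N True that p pq
        by (simp add: I_def J_def powr_powr)
      have "I \<le> 0"
      proof (rule ennreal_le_epsilon)
        fix e :: real assume e: "0 < e"
        have "C * (e / (C + 1)) \<le> e" using C e by (simp add: field_simps)
        then have "ennreal (C * (e / (C + 1))) \<le> ennreal e" by (rule ennreal_leI)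
        moreover have "I \<le> ennreal (C * (e / (C + 1)))" using C e by (intro le) simp
        ultimately show "I \<le> 0 + ennreal e" by simp
      qed
      then show ?thesis by simp
    qed
    have "ennreal_powr I (1 / q) \<le> ennreal ((C * N powr (q / p)) powr (1 / q))"
      using I C p pq by (intro ennreal_powr_le) auto
    also have "(C * N powr (q / p)) powr (1 / q) = C powr (1 / q) * N powr (1 / p)"
      using p pq by (simp add: powr_mult powr_powr)
    also have "ennreal \<dots> = ennreal (C powr (1 / q)) * ennreal_powr J (1 / p)"
      using N by (simp add: ennreal_powr_def ennreal_mult)
    finally show ?thesis unfolding Lp_norm_def I_def J_def .
  qed
  then show ?thesis unfolding cs_embedding_def by (intro exI[of _ "C powr (1 / q)"]) auto
qed

section \<open>Capacity and Carleson measures\<close>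

text \<open>For (x, t) in the tent, \<open>ball x t\<close> lies in the doubled ball. The kernel is
  at least a constant times t^(-n) on it, which its volume cancels.\<close>

lemma cs_extension_indicator_ge:
  fixes x\<^sub>0 :: "real^'n"
  assumes \<alpha>: "0 < \<alpha>" and z: "z \<in> tent x\<^sub>0 R"
  shows "cs_const CARD('n) \<alpha> * 2 powr (- ((real CARD('n) + \<alpha>) / 2)) * unit_ball_vol (real CARD('n))
    \<le> cs_extension \<alpha> (indicator (ball x\<^sub>0 (2 * R))) z"
proof -
  obtain x t where zxt: "z = (x, t)" by force
  have t: "0 < t" "t < R" "dist x\<^sub>0 x < R" using z by (auto simp: tent_def zxt)
  let ?k = "cs_const CARD('n) \<alpha> * 2 powr (- ((real CARD('n) + \<alpha>) / 2)) / t ^ CARD('n)"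
  have k0: "0 \<le> ?k" using t cs_const_pos[OF \<alpha>, of "CARD('n)"] by simp
  have sub: "ball x t \<subseteq> ball x\<^sub>0 (2 * R)"
  proof
    fix y assume "y \<in> ball x t"
    then show "y \<in> ball x\<^sub>0 (2 * R)" using t dist_triangle[of x\<^sub>0 y x] by simp
  qed
  let ?g = "\<lambda>y. cs_kernel \<alpha> t (x - y) * indicator (ball x\<^sub>0 (2 * R)) y"
  have up: "cs_kernel \<alpha> t y \<le> cs_const CARD('n) \<alpha> / t ^ CARD('n)" for y :: "real^'n"
  proof -
    obtain k where "cs_kernel \<alpha> t y \<le> cs_const CARD('n) \<alpha> * (2 ^ k) powr (- (real CARD('n) + \<alpha>)) / t ^ CARD('n)"
      using cs_kernel_le_dyadic[OF \<alpha> t(1)] by blast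
    also have "\<dots> \<le> cs_const CARD('n) \<alpha> * 1 / t ^ CARD('n)"
    proof -
      have "(2 ^ k) powr (- (real CARD('n) + \<alpha>)) \<le> (1::real) powr (- (real CARD('n) + \<alpha>))"
        using \<alpha> by (intro powr_mono2') auto
      then show ?thesis using cs_const_pos[OF \<alpha>, of "CARD('n)"] t
        by (intro divide_right_mono mult_left_mono) auto
    qed
    finally show ?thesis by simp
  qed
  \<comment> \<open>A lower bound needs genuine integrability, as the integral would otherwise
    default to 0.\<close>
  have int: "integrable lebesgue ?g"
  proof (rule Bochner_Integration.integrable_bound)
    show "integrable lebesgue (\<lambda>y. cs_const CARD('n) \<alpha> / t ^ CARD('n) * indicator (ball x\<^sub>0 (2 * R)) y)"
      using t by (intro integrable_mult_right integrable_real_indicator)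
        (auto simp: emeasure_ball)
    have [measurable]: "ball x\<^sub>0 (2 * R) \<in> sets borel" by simp
    show "?g \<in> borel_measurable lebesgue" by (rule measurable_completion) measurable
    show "AE y in lebesgue. norm (?g y) \<le> norm (cs_const CARD('n) \<alpha> / t ^ CARD('n) * indicator (ball x\<^sub>0 (2 * R)) y)"
      using up cs_const_pos[OF \<alpha>, of "CARD('n)"] t
      by (intro AE_I2) (auto simp: indicator_def abs_of_nonneg[OF cs_kernel_nonneg[OF \<alpha>]])
  qed
  have "?k * (unit_ball_vol (real CARD('n)) * t ^ CARD('n)) = (\<integral>y. ?k * indicator (ball x t) y \<partial>lebesgue)"
    using t by (simp add: measure_def emeasure_ball)
  also have "\<dots> \<le> (\<integral>y. ?g y \<partial>lebesgue)"
  proof (rule integral_mono[OF _ int])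
    show "integrable lebesgue (\<lambda>y. ?k * indicator (ball x t) y)"
      using t by (intro integrable_mult_right integrable_real_indicator)
        (auto simp: emeasure_ball)
    fix y
    show "?k * indicator (ball x t) y \<le> ?g y"
      using cs_kernel_ge[OF \<alpha> t(1), of "x - y"] sub cs_kernel_nonneg[OF \<alpha>, of t "x - y"]
      by (auto simp: indicator_def dist_norm)
  qed
  finally show ?thesis using t by (simp add: zxt cs_extension_def)
qed

text \<open>Chebyshev bounds \<mu>(K)^(1/q) by the norm of an admissible \<open>f\<close>; raising
  to the power p gives the quantity minimised by the capacity, hence the exponent p/q.\<close>

lemma cs_embedding_imp_capacity_bound:
  fixes \<mu> :: "((real^'n) \<times> real) measure"
  assumes sets: "sets \<mu> = sets (restrict_space borel upper_half_space)"
    and emb: "cs_embedding \<alpha> p q \<mu>" and p: "1 < p" and pq: "p \<le> q"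
  shows "(SUP l\<in>{0<..}. ennreal (l powr (p / q)) / min_capacity \<alpha> p \<mu> l) < \<infinity>"
proof -
  obtain C0 where C0: "0 \<le> C0"
    and emb: "\<And>f. f \<in> Lp_space lebesgue p \<Longrightarrow>
        Lp_norm \<mu> q (cs_extension \<alpha> f) \<le> ennreal C0 * Lp_norm lebesgue p f"
    using emb unfolding cs_embedding_def by blast
  \<comment> \<open>Adding 1 makes C positive: \<open>C powr p\<close> becomes a legitimate divisor,
    and its product with an infinite norm is infinite.\<close>
  define C where "C = C0 + 1"
  have C: "0 < C" using C0 by (simp add: C_def)
  have q: "0 < q" using p pq by simp
  have le: "ennreal (l powr (p / q)) \<le> ennreal (C powr p) * ennreal_powr (Lp_norm lebesgue p f) p"
    if l: "0 < l" and K: "compact K" "K \<subseteq> upper_half_space" "ennreal l \<le> emeasure \<mu> K"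
      and f: "f \<in> borel_measurable lebesgue" "\<And>z. z \<in> K \<Longrightarrow> 1 \<le> cs_extension \<alpha> f z"
    for l K f
  proof (cases "Lp_norm lebesgue p f = top")
    case True
    then show ?thesis using C by (simp add: ennreal_powr_def ennreal_mult_top)
  next
    case False
    then have fL: "f \<in> Lp_space lebesgue p" using f by (simp add: Lp_space_def top.not_eq_extremum)
    obtain b where b: "Lp_norm lebesgue p f = ennreal b" "0 \<le> b" using False by (cases "Lp_norm lebesgue p f") auto
    have Ks: "K \<in> sets \<mu>"
      by (rule sets_upper_half_space_borel[OF sets borel_compact[OF K(1)] K(2)])
    define I where "I = (\<integral>\<^sup>+z. ennreal (\<bar>cs_extension \<alpha> f z\<bar> powr q) \<partial>\<mu>)"
    have "emeasure \<mu> K = (\<integral>\<^sup>+z. indicator K z \<partial>\<mu>)" using Ks by simp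
    also have "\<dots> \<le> I" unfolding I_def
    proof (rule nn_integral_mono)
      fix z
      show "indicator K z \<le> ennreal (\<bar>cs_extension \<alpha> f z\<bar> powr q)"
      proof (cases "z \<in> K")
        case True
        then have "1 \<le> \<bar>cs_extension \<alpha> f z\<bar> powr q" using f(2)[OF True] q by (intro ge_one_powr_ge_zero) auto
        then show ?thesis using True by simp
      qed simp
    qed
    finally have "ennreal l \<le> I" using K(3) by simp
    moreover have I: "ennreal_powr I (1 / q) \<le> ennreal (C0 * b)"
      using emb[OF fL] C0 b by (simp add: Lp_norm_def I_def ennreal_mult')
    then have "I \<noteq> top" by (auto simp: ennreal_powr_def top_unique)
    then obtain i where i: "I = ennreal i" "0 \<le> i" by (cases I) auto
    ultimately have "l \<le> i" by simp
    then have "l powr (1 / q) \<le> i powr (1 / q)" using l q by (intro powr_mono2) auto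
    also have "\<dots> \<le> C0 * b" using I i C0 b by (simp add: ennreal_powr_def)
    also have "\<dots> \<le> C * b" using b by (simp add: C_def mult_right_mono)
    finally have "(l powr (1 / q)) powr p \<le> (C * b) powr p" using p by (intro powr_mono2) auto
    then have "l powr (p / q) \<le> C powr p * b powr p" by (simp add: powr_powr powr_mult)
    then have "ennreal (l powr (p / q)) \<le> ennreal (C powr p * b powr p)" by (rule ennreal_leI)
    then show ?thesis using b by (simp add: ennreal_powr_def ennreal_mult')
  qed
  have "ennreal (l powr (p / q)) / min_capacity \<alpha> p \<mu> l \<le> ennreal (C powr p)" if l: "0 < l" for l
  proof -
    \<comment> \<open>This includes the case that no compact set has measure at least
      \<open>l\<close>: the infimum is then \<open>top\<close>.\<close>
    have "ennreal (l powr (p / q)) / ennreal (C powr p) \<le> min_capacity \<alpha> p \<mu> l"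
      unfolding min_capacity_def Lp_capacity_def
    proof (intro INF_greatest, clarify)
      fix K f assume "compact K" "K \<subseteq> upper_half_space" "ennreal l \<le> emeasure \<mu> K"
        "f \<in> borel_measurable lebesgue" "\<forall>z\<in>K. 1 \<le> cs_extension \<alpha> f z"
      then have "ennreal (l powr (p / q)) \<le> ennreal (C powr p) * ennreal_powr (Lp_norm lebesgue p f) p"
        using le[OF l] by blast
      then show "ennreal (l powr (p / q)) / ennreal (C powr p) \<le> ennreal_powr (Lp_norm lebesgue p f) p"
        using C by (intro divide_le_posI_ennreal) (auto simp: mult.commute)
    qed
    moreover have "0 < ennreal (l powr (p / q)) / ennreal (C powr p)"
      using l C by (simp add: ennreal_zero_less_divide)
    \<comment> \<open>Positivity rules out the quotient a/0 = \<open>top\<close>.\<close>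
    ultimately have pos: "0 < min_capacity \<alpha> p \<mu> l"
      and le: "ennreal (l powr (p / q)) / ennreal (C powr p) \<le> min_capacity \<alpha> p \<mu> l" by auto
    have "ennreal (l powr (p / q)) = ennreal (C powr p) * (ennreal (l powr (p / q)) / ennreal (C powr p))"
      using l C by (simp add: divide_ennreal ennreal_mult'[symmetric])
    also have "\<dots> \<le> ennreal (C powr p) * min_capacity \<alpha> p \<mu> l" using le by (rule mult_left_mono) simp
    finally show ?thesis using pos by (intro divide_le_posI_ennreal) (auto simp: mult.commute)
  qed
  then have "(SUP l\<in>{0<..}. ennreal (l powr (p / q)) / min_capacity \<alpha> p \<mu> l) \<le> ennreal (C powr p)"
    by (intro SUP_least) auto
  also have "\<dots> < \<infinity>" by simp
  finally show ?thesis .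
qed

text \<open>\<open>min_capacity\<close> sees \<mu> only through compact sets. Each compact K in a
  tent is tested at the level l = \<mu>(K), and inner regularity passes the bound to the open
  tent.\<close>

lemma capacity_bound_imp_carleson:
  fixes \<mu> :: "((real^'n) \<times> real) measure"
  assumes radon: "radon_measure_on upper_half_space \<mu>"
    and cap: "(SUP l\<in>{0<..}. ennreal (l powr (p / q)) / min_capacity \<alpha> p \<mu> l) < \<infinity>"
    and p: "1 < p" and pq: "p \<le> q" and \<alpha>: "0 < \<alpha>"
  obtains A where "0 \<le> A" "carleson A (q / p) \<mu>"
proof -
  let ?n = "CARD('n)" and ?\<omega> = "unit_ball_vol (real CARD('n))"
  obtain S where S: "(SUP l\<in>{0<..}. ennreal (l powr (p / q)) / min_capacity \<alpha> p \<mu> l) = ennreal S" "0 \<le> S"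
    using cap by (cases "SUP l\<in>{0<..}. ennreal (l powr (p / q)) / min_capacity \<alpha> p \<mu> l") auto
  \<comment> \<open>The lower bound from \<open>cs_extension_indicator_ge\<close>; dividing the
    indicator by it gives an admissible function.\<close>
  define \<kappa> where "\<kappa> = cs_const ?n \<alpha> * 2 powr (- ((real ?n + \<alpha>) / 2)) * ?\<omega>"
  have \<kappa>: "0 < \<kappa>" unfolding \<kappa>_def using cs_const_pos[OF \<alpha>, of ?n] by simp
  have q: "0 < q" using p pq by simp
  \<comment> \<open>Obtained by solving l^(p/q) <= S V for l, where V is the p-th power of the norm
    of the test function.\<close>
  define A where "A = (S * (\<kappa> powr (- p) * (?\<omega> * 2 ^ ?n))) powr (q / p)"
  have compact: "emeasure \<mu> K \<le> ennreal (A * (R ^ ?n) powr (q / p))"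
    if R: "0 < R" and K: "compact K" "K \<subseteq> tent x R" for K x R
  proof -
    have Ku: "K \<subseteq> upper_half_space" using K tent_subset by blast
    then have "emeasure \<mu> K < \<infinity>" using radon K unfolding radon_measure_on_def by blast
    then obtain l where l: "emeasure \<mu> K = ennreal l" "0 \<le> l" by (cases "emeasure \<mu> K") auto
    show ?thesis
    proof (cases "l = 0")
      case False
      define V where "V = \<kappa> powr (- p) * (?\<omega> * 2 ^ ?n) * R ^ ?n"
      have V: "0 < V" using \<kappa> R by (simp add: V_def)
      let ?f = "\<lambda>y. indicator (ball x (2 * R)) y / \<kappa>"
      have "Lp_capacity \<alpha> p K \<le> ennreal_powr (Lp_norm lebesgue p ?f) p"
        unfolding Lp_capacity_def
      proof (rule INF_lower, clarify, intro conjI allI ballI)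
        have [measurable]: "ball x (2 * R) \<in> sets lebesgue" by simp
        show "?f \<in> borel_measurable lebesgue" by measurable
        show "0 \<le> ?f y" for y using \<kappa> by simp
        fix z assume z: "z \<in> K"
        have "cs_extension \<alpha> ?f z = cs_extension \<alpha> (indicator (ball x (2 * R))) z / \<kappa>"
          by (simp add: cs_extension_def case_prod_beta)
        moreover have "\<kappa> \<le> cs_extension \<alpha> (indicator (ball x (2 * R))) z"
          unfolding \<kappa>_def using z K by (intro cs_extension_indicator_ge[OF \<alpha>]) auto
        ultimately show "1 \<le> cs_extension \<alpha> ?f z" using \<kappa> by simp
      qed
      also have "\<dots> = ennreal V"
      proof -
        have "(\<integral>\<^sup>+y. ennreal (\<bar>?f y\<bar> powr p) \<partial>lebesgue)
            = (\<integral>\<^sup>+y. ennreal (\<kappa> powr (- p)) * indicator (ball x (2 * R)) y \<partial>lebesgue)"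
          using \<kappa> by (intro nn_integral_cong) (auto simp: indicator_def powr_divide powr_minus_divide)
        also have "\<dots> = ennreal (\<kappa> powr (- p)) * emeasure lebesgue (ball x (2 * R))"
          by (rule nn_integral_cmult_indicator) simp
        also have "\<dots> = ennreal V"
          using R by (subst emeasure_lebesgue_ball) (auto simp: V_def ennreal_mult'[symmetric] power_mult_distrib mult_ac)
        finally show ?thesis using V p by (simp add: Lp_norm_def ennreal_powr_def powr_powr)
      qed
      finally have cap_le: "Lp_capacity \<alpha> p K \<le> ennreal V" .
      have "min_capacity \<alpha> p \<mu> l \<le> Lp_capacity \<alpha> p K"
        unfolding min_capacity_def using K Ku l by (intro INF_lower) auto
      with cap_le have "min_capacity \<alpha> p \<mu> l \<le> ennreal V" by simp
      then obtain m where m: "min_capacity \<alpha> p \<mu> l = ennreal m" "0 \<le> m" "m \<le> V"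
        using V by (cases "min_capacity \<alpha> p \<mu> l") (auto simp: top_unique)
      have quot: "ennreal (l powr (p / q)) / ennreal m \<le> ennreal S"
        unfolding S(1)[symmetric] m(1)[symmetric] using False l by (intro SUP_upper) auto
      \<comment> \<open>A vanishing capacity would make the quotient \<open>top\<close>, against the
        finite supremum.\<close>
      have m0: "0 < m"
      proof (rule ccontr)
        assume "\<not> 0 < m"
        then have "ennreal (l powr (p / q)) / ennreal m = top" using m False l by simp
        with quot show False by (simp add: top_unique)
      qed
      then have "l powr (p / q) / m \<le> S" using quot S by (simp add: divide_ennreal)
      then have "l powr (p / q) \<le> S * m" using m0 by (simp add: field_simps)
      also have "\<dots> \<le> S * V" using m S by (intro mult_left_mono) auto
      finally have "l powr (p / q) \<le> S * V" .
      then have "(l powr (p / q)) powr (q / p) \<le> (S * V) powr (q / p)" using p q by (intro powr_mono2) auto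
      moreover have "(l powr (p / q)) powr (q / p) = l" using p q l by (simp add: powr_powr)
      moreover have "(S * V) powr (q / p) = A * (R ^ ?n) powr (q / p)"
        unfolding A_def V_def by (simp only: powr_mult mult_ac)
      ultimately show ?thesis using l by (simp add: ennreal_leI)
    qed (use l in simp)
  qed
  have "carleson A (q / p) \<mu>"
    unfolding carleson_def
  proof (intro allI impI)
    fix x :: "real^'n" and R :: real assume R: "0 < R"
    have "openin (top_of_set upper_half_space) (tent x R)"
      by (intro open_subset open_tent tent_subset)
    then have "emeasure \<mu> (tent x R) = (SUP K\<in>{K. compact K \<and> K \<subseteq> tent x R}. emeasure \<mu> K)"
      using radon unfolding radon_measure_on_def by blast
    also have "\<dots> \<le> ennreal (A * (R ^ ?n) powr (q / p))"
      using compact[OF R] by (intro SUP_least) auto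
    finally show "emeasure \<mu> (tent x R) \<le> ennreal (A * (R ^ ?n) powr (q / p))" .
  qed
  then show ?thesis using that[of A] by (simp add: A_def)
qed

section \<open>Box conditions\<close>

text \<open>The heights of the box stay below t0 + 2r, at most (c + 2) r, and its base has radius
  r/2, so a tent of radius (c + 2) r contains it.\<close>

lemma carleson_imp_box_bound:
  fixes \<mu> :: "((real^'n) \<times> real) measure"
  assumes sets: "sets \<mu> = sets (restrict_space borel upper_half_space)"
    and car: "carleson A (q / p) \<mu>" and A: "0 \<le> A" and c: "0 < c"
  shows "(SUP (r, x\<^sub>0, t\<^sub>0)\<in>{(r, x\<^sub>0, t\<^sub>0). 0 < r \<and> (x\<^sub>0, t\<^sub>0) \<in> upper_half_space \<and> t\<^sub>0 \<le> c * r}.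
      emeasure \<mu> (cs_box r x\<^sub>0 t\<^sub>0) / ennreal (r powr (q * real CARD('n) / p))) < \<infinity>"
proof -
  let ?n = "CARD('n)"
  define B where "B = A * ((c + 2) ^ ?n) powr (q / p)"
  have B: "0 \<le> B" using A by (simp add: B_def)
  have "emeasure \<mu> (cs_box r x\<^sub>0 t\<^sub>0) / ennreal (r powr (q * real ?n / p)) \<le> ennreal B"
    if r: "0 < r" and t: "t\<^sub>0 \<le> c * r" for r t\<^sub>0 and x\<^sub>0 :: "real^'n"
  proof -
    have "r < 2 * ((c + 2) * r)" using r c by (simp add: field_simps add_pos_pos)
    then have sub: "cs_box r x\<^sub>0 t\<^sub>0 \<subseteq> tent x\<^sub>0 ((c + 2) * r)"
      using t unfolding cs_box_def tent_def upper_half_space_def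
      by (auto simp: dist_norm norm_minus_commute algebra_simps)
    have "emeasure \<mu> (cs_box r x\<^sub>0 t\<^sub>0) \<le> emeasure \<mu> (tent x\<^sub>0 ((c + 2) * r))"
      by (rule emeasure_mono[OF sub sets_upper_half_space_open[OF sets open_tent tent_subset]])
    also have "\<dots> \<le> ennreal (A * (((c + 2) * r) ^ ?n) powr (q / p))"
      using r c by (intro carlesonD[OF car]) simp
    also have "A * (((c + 2) * r) ^ ?n) powr (q / p) = r powr (q * real ?n / p) * B"
    proof -
      have "(r ^ ?n) powr (q / p) = r powr (q * real ?n / p)"
        using r by (simp add: powr_realpow[symmetric] powr_powr mult.commute)
      then show ?thesis by (simp add: B_def power_mult_distrib powr_mult)
    qed
    also have "ennreal \<dots> = ennreal B * ennreal (r powr (q * real ?n / p))"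
      using B by (simp add: ennreal_mult mult.commute)
    finally show ?thesis using r by (intro divide_le_posI_ennreal) (auto simp: mult.commute)
  qed
  then have "(SUP (r, x\<^sub>0, t\<^sub>0)\<in>{(r, x\<^sub>0, t\<^sub>0). 0 < r \<and> (x\<^sub>0, t\<^sub>0) \<in> upper_half_space \<and> t\<^sub>0 \<le> c * r}.
      emeasure \<mu> (cs_box r (x\<^sub>0 :: real^'n) t\<^sub>0) / ennreal (r powr (q * real ?n / p))) \<le> ennreal B"
    by (intro SUP_least) auto
  also have "\<dots> < \<infinity>" by simp
  finally show ?thesis .
qed

text \<open>A box with \<open>t\<^sub>0 > 0\<close> covers heights in \<open>(r + t\<^sub>0, 2 r + t\<^sub>0)\<close>, a range of ratio below 2, so
  the layers have to be thinner than dyadic ones; ratio 3/2 leaves room.\<close>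

lemma emeasure_layer_le:
  fixes \<mu> :: "((real^'n) \<times> real) measure"
  assumes sets: "sets \<mu> = sets (restrict_space borel upper_half_space)"
    and A: "0 \<le> A" and s: "1 \<le> s" and c: "0 < c" and \<sigma>: "0 < \<sigma>" "\<sigma> \<le> R"
    and box: "\<And>r t\<^sub>0 x\<^sub>0. 0 < r \<Longrightarrow> 0 < t\<^sub>0 \<Longrightarrow> t\<^sub>0 \<le> c * r \<Longrightarrow>
      emeasure \<mu> (cs_box r x\<^sub>0 t\<^sub>0) \<le> ennreal (A * (r ^ CARD('n)) powr s)"
  shows "emeasure \<mu> (ball x R \<times> {\<sigma>..<3/2 * \<sigma>})
    \<le> ennreal (A * (20 ^ CARD('n)) powr s * (\<sigma> ^ CARD('n)) powr (s - 1) * R ^ CARD('n))"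
proof -
  let ?n = "CARD('n)" and ?\<omega> = "unit_ball_vol (real CARD('n))"
  \<comment> \<open>The box over height r + \<open>t\<^sub>0\<close> <= 19/20 \<sigma> and up to 2r
    + \<open>t\<^sub>0\<close> > 9/5 \<sigma> spans the layer. The minimum with
    \<open>9/10 * c\<close> gives \<open>t\<^sub>0 \<le> c * r\<close> even for small c, while
    \<open>t\<^sub>0\<close> remains positive as \<open>box\<close> demands.\<close>
  define r where "r = 9/10 * \<sigma>"
  define t\<^sub>0 where "t\<^sub>0 = min (1/20) (9/10 * c) * \<sigma>"
  have r: "0 < r" "r \<le> \<sigma>" using \<sigma> by (auto simp: r_def)
  have t0: "0 < t\<^sub>0" "t\<^sub>0 \<le> 1/20 * \<sigma>" "t\<^sub>0 \<le> c * r"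
  proof -
    show "0 < t\<^sub>0" using \<sigma> c by (simp add: t\<^sub>0_def)
    show "t\<^sub>0 \<le> 1/20 * \<sigma>" unfolding t\<^sub>0_def using \<sigma> by (intro mult_right_mono) auto
    have "t\<^sub>0 \<le> 9/10 * c * \<sigma>" unfolding t\<^sub>0_def using \<sigma> by (intro mult_right_mono) auto
    then show "t\<^sub>0 \<le> c * r" by (simp add: r_def)
  qed
  define b where "b = A * (10 ^ ?n) powr s * (\<sigma> ^ ?n) powr (s - 1) / ?\<omega>"
  have b: "0 \<le> b" using A by (simp add: b_def)
  have "emeasure \<mu> (ball x R \<times> {\<sigma>..<3/2 * \<sigma>}) \<le> ennreal b * emeasure lebesgue (ball x (2 * R))"
  \<comment> \<open>The radius r/10 is chosen because five times it is r/2, the base radius of a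
    box. The pieces are vertical segments, and the Vitali lemma selects countably many boxes
    covering all of them.\<close>
  proof (rule vitali_cover_emeasure_le[where K = "ball x R" and a = "\<lambda>y. y" and r = "\<lambda>_. r / 10"
        and B = "r / 10" and T = "\<lambda>y. cs_box r y t\<^sub>0" and s = "\<lambda>y. {y} \<times> {\<sigma>..<3/2 * \<sigma>}"], goal_cases)
    case (2 y)
    have "cs_box r y t\<^sub>0 = ball y (r / 2) \<times> ({r + t\<^sub>0<..<2 * r + t\<^sub>0} \<inter> {0<..})"
      by (auto simp: cs_box_def upper_half_space_def dist_norm norm_minus_commute)
    then have "open (cs_box r y t\<^sub>0)" by (auto intro!: open_Times open_Int)
    then show ?case by (rule sets_upper_half_space_open[OF sets]) (auto simp: cs_box_def)
  next
    case (5 y)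
    show ?case
    proof
      fix z assume "z \<in> ball y (r / 10)"
      then show "z \<in> ball x (2 * R)" using 5 r \<sigma> dist_triangle[of x z y] by simp
    qed
  next
    case (7 y z)
    have d: "dist y z < r / 2" using 7(3) r by simp
    have "r + t\<^sub>0 < \<sigma>" "3/2 * \<sigma> < 2 * r + t\<^sub>0" using t0 \<sigma> by (auto simp: r_def)
    then show ?case using d \<sigma> by (auto simp: cs_box_def upper_half_space_def dist_norm)
  next
    case (8 y)
    have "emeasure \<mu> (cs_box r y t\<^sub>0) \<le> ennreal (A * (r ^ ?n) powr s)"
      using r t0 by (intro box)
    also have "\<dots> \<le> ennreal (b * (?\<omega> * (r / 10) ^ ?n))"
    proof (rule ennreal_leI)
      have "(r ^ ?n) powr s = (10 ^ ?n) powr s * (((r / 10) ^ ?n) powr (s - 1) * (r / 10) ^ ?n)"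
        using r by (simp add: power_divide powr_divide powr_diff)
      also have "\<dots> \<le> (10 ^ ?n) powr s * ((\<sigma> ^ ?n) powr (s - 1) * (r / 10) ^ ?n)"
        using r s by (intro mult_left_mono mult_right_mono powr_mono2 power_mono) auto
      finally have "A * (r ^ ?n) powr s \<le> A * ((10 ^ ?n) powr s * ((\<sigma> ^ ?n) powr (s - 1) * (r / 10) ^ ?n))"
        using A by (rule mult_left_mono)
      also have "\<dots> = b * (?\<omega> * (r / 10) ^ ?n)" by (simp add: b_def)
      finally show "A * (r ^ ?n) powr s \<le> \<dots>" .
    qed
    also have "\<dots> = ennreal b * emeasure lebesgue (ball y (r / 10))"
      using r b by (subst emeasure_lebesgue_ball) (auto simp: ennreal_mult')
    finally show ?case .
  qed (use r in auto)
  also have "\<dots> = ennreal (b * (?\<omega> * (2 * R) ^ ?n))"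
    using \<sigma> b by (subst emeasure_lebesgue_ball) (auto simp: ennreal_mult')
  also have "\<dots> \<le> ennreal (A * (20 ^ ?n) powr s * (\<sigma> ^ ?n) powr (s - 1) * R ^ ?n)"
  proof (rule ennreal_leI)
    \<comment> \<open>Vitali balls about points of \<open>ball x R\<close> may stick out, so the
      base ball was doubled; s >= 1 absorbs the resulting 2^n and turns 10 into 20.\<close>
    have "(2 ^ ?n) powr 1 \<le> (2 ^ ?n :: real) powr s" using s by (intro powr_mono) auto
    then have "(10 ^ ?n) powr s * 2 ^ ?n \<le> (10 ^ ?n) powr s * (2 ^ ?n :: real) powr s"
      by (intro mult_left_mono) auto
    also have "\<dots> = (20 ^ ?n) powr s" by (simp flip: powr_mult power_mult_distrib)
    finally have "A * (\<sigma> ^ ?n) powr (s - 1) * R ^ ?n * ((10 ^ ?n) powr s * 2 ^ ?n)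
        \<le> A * (\<sigma> ^ ?n) powr (s - 1) * R ^ ?n * (20 ^ ?n) powr s"
      using A \<sigma> by (intro mult_left_mono) auto
    then show "b * (?\<omega> * (2 * R) ^ ?n) \<le> A * (20 ^ ?n) powr s * (\<sigma> ^ ?n) powr (s - 1) * R ^ ?n"
      by (simp add: b_def power_mult_distrib mult_ac)
  qed
  finally show ?thesis .
qed

text \<open>A box of size r stays above height r, so exhausting a tent takes infinitely many layers
  near the boundary, and their bounds have to form a convergent series.\<close>

lemma box_bound_imp_carleson:
  fixes \<mu> :: "((real^'n) \<times> real) measure"
  assumes sets: "sets \<mu> = sets (restrict_space borel upper_half_space)"
    and p: "1 < p" and pq: "p < q" and c: "0 < c"
    and bound: "(SUP (r, x\<^sub>0, t\<^sub>0)\<in>{(r, x\<^sub>0, t\<^sub>0). 0 < r \<and> (x\<^sub>0, t\<^sub>0) \<in> upper_half_space \<and> t\<^sub>0 \<le> c * r}.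
      emeasure \<mu> (cs_box r x\<^sub>0 t\<^sub>0) / ennreal (r powr (q * real CARD('n) / p))) < \<infinity>" (is "?SUP < \<infinity>")
  obtains A where "0 \<le> A" "carleson A (q / p) \<mu>"
proof -
  let ?n = "CARD('n)"
  define s where "s = q / p"
  have s: "1 < s" using p pq by (simp add: s_def)
  define A where "A = enn2real ?SUP"
  have "ennreal A = ?SUP"
    unfolding A_def using bound unfolding infinity_ennreal_def by (rule ennreal_enn2real)
  note A = this[symmetric]
  have A0: "0 \<le> A" unfolding A_def by (rule enn2real_nonneg)
  have box: "emeasure \<mu> (cs_box r x\<^sub>0 t\<^sub>0) \<le> ennreal (A * (r ^ ?n) powr s)"
    if r: "0 < r" and t: "0 < t\<^sub>0" "t\<^sub>0 \<le> c * r" for r t\<^sub>0 and x\<^sub>0 :: "real^'n"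
  proof -
    have "(r ^ ?n) powr s = r powr (q * real ?n / p)"
      using r by (simp add: s_def powr_realpow[symmetric] powr_powr mult.commute)
    moreover have "emeasure \<mu> (cs_box r x\<^sub>0 t\<^sub>0) / ennreal (r powr (q * real ?n / p)) \<le> ennreal A"
      unfolding A[symmetric] using r t
      by (intro SUP_upper2[of "(r, x\<^sub>0, t\<^sub>0)"]) (auto simp: upper_half_space_def)
    then have "emeasure \<mu> (cs_box r x\<^sub>0 t\<^sub>0) / ennreal (r powr (q * real ?n / p)) * ennreal (r powr (q * real ?n / p))
        \<le> ennreal A * ennreal (r powr (q * real ?n / p))"
      by (rule mult_right_mono) simp
    moreover have "emeasure \<mu> (cs_box r x\<^sub>0 t\<^sub>0) / ennreal (r powr (q * real ?n / p)) * ennreal (r powr (q * real ?n / p))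
      = emeasure \<mu> (cs_box r x\<^sub>0 t\<^sub>0)"
      using r by (simp add: ennreal_divide_times)
    ultimately show ?thesis using A0 by (simp add: ennreal_mult')
  qed
  \<comment> \<open>The ratio between the bounds of consecutive layers; it is below 1 because s > 1,
    which is where p < q enters.\<close>
  define \<theta> where "\<theta> = ((2/3 :: real) ^ ?n) powr (s - 1)"
  have \<theta>: "0 < \<theta>" "\<theta> < 1"
  proof -
    show "0 < \<theta>" by (simp add: \<theta>_def)
    have "(2/3 :: real) ^ ?n < 1" by (simp add: power_less_one_iff)
    then have "\<theta> < 1 powr (s - 1)" unfolding \<theta>_def using s by (intro powr_less_mono2) auto
    then show "\<theta> < 1" by simp
  qed
  define B where "B = A * (20 ^ ?n) powr s"
  have B: "0 \<le> B" using A0 by (simp add: B_def)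
  have "emeasure \<mu> (tent x R) \<le> ennreal (B / (1 - \<theta>) * (R ^ ?n) powr s)" if R: "0 < R" for x :: "real^'n" and R
  proof -
    \<comment> \<open>With the exponent k + 1 the top 3/2 \<sigma>(k) of a layer is the bottom of
      the preceding one, and the top of layer 0 is R. The half-open layers therefore fit together
      without gaps.\<close>
    define \<sigma> where "\<sigma> k = (2/3) ^ (k + 1) * R" for k :: nat
    define Y where "Y k = ball x R \<times> {\<sigma> k..<3/2 * \<sigma> k}" for k
    have \<sigma>: "0 < \<sigma> k" "\<sigma> k \<le> R" "\<sigma> k \<le> (2/3) ^ k * R" for k
    proof -
      show "0 < \<sigma> k" using R by (simp add: \<sigma>_def)
      have "(2/3 :: real) ^ (k + 1) \<le> 1" by (rule power_le_one) auto
      then show "\<sigma> k \<le> R" using R unfolding \<sigma>_def by (metis mult_right_mono mult_1 less_imp_le)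
      show "\<sigma> k \<le> (2/3) ^ k * R" using R by (simp add: \<sigma>_def)
    qed
    have sub: "tent x R \<subseteq> (\<Union>k. Y k)"
    proof
      fix z assume "z \<in> tent x R"
      then obtain y t where z: "z = (y, t)" "y \<in> ball x R" "0 < t" "t < R" by (auto simp: tent_def)
      obtain m :: nat where "(2/3) ^ m < t / R" using real_arch_pow_inv[of "t / R" "2/3"] z R by auto
      then have "(2/3) ^ m * R < t" using R by (simp add: field_simps)
      then have m: "\<sigma> m \<le> t" using \<sigma>(3)[of m] by simp
      define k where "k = (LEAST k. \<sigma> k \<le> t)"
      have k: "\<sigma> k \<le> t" unfolding k_def using m by (rule LeastI)
      have "t < 3/2 * \<sigma> k"
      proof (cases k)
        case 0
        then show ?thesis using z by (simp add: \<sigma>_def)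
      next
        case (Suc i)
        then have "i < k" by simp
        then have "\<not> \<sigma> i \<le> t" unfolding k_def by (rule not_less_Least)
        then show ?thesis by (simp add: Suc \<sigma>_def not_le mult_ac)
      qed
      then show "z \<in> (\<Union>k. Y k)" using k z by (auto simp: Y_def)
    qed
    have Ysets: "Y k \<in> sets \<mu>" for k
    proof (rule sets_upper_half_space_borel[OF sets])
      show "Y k \<in> sets borel" unfolding Y_def by (intro borel_Times) auto
      show "Y k \<subseteq> upper_half_space" using \<sigma>(1)[of k] by (auto simp: Y_def upper_half_space_def)
    qed
    have layer: "emeasure \<mu> (Y k) \<le> ennreal (B * (R ^ ?n) powr s) * ennreal (\<theta> ^ k)" for k
    proof -
      have "emeasure \<mu> (Y k) \<le> ennreal (A * (20 ^ ?n) powr s * (\<sigma> k ^ ?n) powr (s - 1) * R ^ ?n)"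
        unfolding Y_def using s \<sigma>[of k] by (intro emeasure_layer_le[OF sets A0 _ c _ _ box]) auto
      also have "\<dots> \<le> ennreal (B * (R ^ ?n) powr s * \<theta> ^ k)"
      proof (rule ennreal_leI)
        have "(\<sigma> k ^ ?n) powr (s - 1) \<le> (((2/3) ^ k * R) ^ ?n) powr (s - 1)"
          using s \<sigma>[of k] by (intro powr_mono2 power_mono) auto
        also have "\<dots> = \<theta> ^ k * (R ^ ?n) powr (s - 1)"
        proof -
          have "((2/3) ^ k * R) ^ ?n = ((2/3) ^ ?n) ^ k * R ^ ?n"
            by (simp only: power_mult_distrib power_mult[symmetric] mult.commute[of k])
          moreover have "(((2/3 :: real) ^ ?n) ^ k) powr (s - 1) = \<theta> ^ k"
            unfolding \<theta>_def by (induction k) (simp_all add: powr_mult)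
          ultimately show ?thesis by (simp only: powr_mult)
        qed
        finally have "(\<sigma> k ^ ?n) powr (s - 1) * R ^ ?n \<le> \<theta> ^ k * (R ^ ?n) powr (s - 1) * R ^ ?n"
          using R by (intro mult_right_mono) auto
        also have "\<dots> = \<theta> ^ k * (R ^ ?n) powr s" using R by (simp add: powr_diff)
        finally have "B * ((\<sigma> k ^ ?n) powr (s - 1) * R ^ ?n) \<le> B * (\<theta> ^ k * (R ^ ?n) powr s)"
          using B by (rule mult_left_mono)
        then show "A * (20 ^ ?n) powr s * (\<sigma> k ^ ?n) powr (s - 1) * R ^ ?n \<le> B * (R ^ ?n) powr s * \<theta> ^ k"
          by (simp add: B_def mult_ac)
      qed
      also have "\<dots> = ennreal (B * (R ^ ?n) powr s) * ennreal (\<theta> ^ k)"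
        using \<theta> by (intro ennreal_mult'') simp
      finally show ?thesis .
    qed
    have "emeasure \<mu> (tent x R) \<le> emeasure \<mu> (\<Union>k. Y k)"
      using Ysets sub by (intro emeasure_mono) auto
    also have "\<dots> \<le> (\<Sum>k. emeasure \<mu> (Y k))"
      using Ysets by (intro emeasure_subadditive_countably) auto
    also have "\<dots> \<le> (\<Sum>k. ennreal (B * (R ^ ?n) powr s) * ennreal (\<theta> ^ k))"
      by (intro suminf_le summableI layer)
    also have "\<dots> = ennreal (B * (R ^ ?n) powr s) * ennreal (1 / (1 - \<theta>))"
      using \<theta> by (simp add: suminf_ennreal_eq[OF _ geometric_sums] del: suminf_ennreal)
    also have "\<dots> = ennreal (B * (R ^ ?n) powr s * (1 / (1 - \<theta>)))"
      using \<theta> by (intro ennreal_mult''[symmetric]) simp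
    finally show ?thesis by simp
  qed
  then have "carleson (B / (1 - \<theta>)) (q / p) \<mu>" unfolding carleson_def s_def by blast
  moreover have "0 \<le> B / (1 - \<theta>)" using B \<theta> by simp
  ultimately show ?thesis using that by blast
qed

theorem theorem3p1:
  fixes \<alpha> p q :: real and \<mu> :: "((real^'n) \<times> real) measure"
  assumes "0 < \<alpha>" and "\<alpha> < 2"
    and "1 < p" and "p \<le> q"
    and "radon_measure_on upper_half_space \<mu>"
  shows "(cs_embedding \<alpha> p q \<mu> \<longleftrightarrow>
           (SUP l\<in>{0<..}. ennreal (l powr (p / q)) / min_capacity \<alpha> p \<mu> l) < \<infinity>) \<and>
         (p < q \<longrightarrow> (\<forall>c>0.
           cs_embedding \<alpha> p q \<mu> \<longleftrightarrow>
           (SUP (r, x\<^sub>0, t\<^sub>0)\<in>{(r, x\<^sub>0, t\<^sub>0). 0 < r \<and> (x\<^sub>0, t\<^sub>0) \<in> upper_half_space \<and> t\<^sub>0 \<le> c * r}.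
              emeasure \<mu> (cs_box r x\<^sub>0 t\<^sub>0) / ennreal (r powr (q * real CARD('n) / p))) < \<infinity>))"
proof -
  have sets: "sets \<mu> = sets (restrict_space borel upper_half_space)"
    using assms(5) unfolding radon_measure_on_def by blast
  have capacity_carleson: "\<exists>A\<ge>0. carleson A (q / p) \<mu>"
    if "(SUP l\<in>{0<..}. ennreal (l powr (p / q)) / min_capacity \<alpha> p \<mu> l) < \<infinity>"
    using capacity_bound_imp_carleson[OF assms(5) that assms(3,4,1)] by blast
  have carleson_embedding: "cs_embedding \<alpha> p q \<mu>" if "\<exists>A\<ge>0. carleson A (q / p) \<mu>"
    using that carleson_imp_cs_embedding[OF sets _ _ assms(3,4,1)] by blast
  have embedding_capacity: "(SUP l\<in>{0<..}. ennreal (l powr (p / q)) / min_capacity \<alpha> p \<mu> l) < \<infinity>"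
    if "cs_embedding \<alpha> p q \<mu>"
    by (rule cs_embedding_imp_capacity_bound[OF sets that assms(3,4)])
  show ?thesis
  proof (intro conjI impI allI)
    show "cs_embedding \<alpha> p q \<mu> \<longleftrightarrow>
        (SUP l\<in>{0<..}. ennreal (l powr (p / q)) / min_capacity \<alpha> p \<mu> l) < \<infinity>"
      using capacity_carleson carleson_embedding embedding_capacity by blast
  next
    fix c :: real assume pq: "p < q" and c: "0 < c"
    show "cs_embedding \<alpha> p q \<mu> \<longleftrightarrow>
        (SUP (r, x\<^sub>0, t\<^sub>0)\<in>{(r, x\<^sub>0, t\<^sub>0). 0 < r \<and> (x\<^sub>0, t\<^sub>0) \<in> upper_half_space \<and> t\<^sub>0 \<le> c * r}.
           emeasure \<mu> (cs_box r x\<^sub>0 t\<^sub>0) / ennreal (r powr (q * real CARD('n) / p))) < \<infinity>"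
    proof
      assume "cs_embedding \<alpha> p q \<mu>"
      \<comment> \<open>The embedding reaches the Carleson condition through the capacity bound,
        where the indicator test functions enter.\<close>
      then obtain A where "0 \<le> A" "carleson A (q / p) \<mu>" using embedding_capacity capacity_carleson by blast
      then show "(SUP (r, x\<^sub>0, t\<^sub>0)\<in>{(r, x\<^sub>0, t\<^sub>0). 0 < r \<and> (x\<^sub>0, t\<^sub>0) \<in> upper_half_space \<and> t\<^sub>0 \<le> c * r}.
           emeasure \<mu> (cs_box r x\<^sub>0 t\<^sub>0) / ennreal (r powr (q * real CARD('n) / p))) < \<infinity>"
        using carleson_imp_box_bound[OF sets _ _ c] by blast
    next
      assume "(SUP (r, x\<^sub>0, t\<^sub>0)\<in>{(r, x\<^sub>0, t\<^sub>0). 0 < r \<and> (x\<^sub>0, t\<^sub>0) \<in> upper_half_space \<and> t\<^sub>0 \<le> c * r}.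
           emeasure \<mu> (cs_box r x\<^sub>0 t\<^sub>0) / ennreal (r powr (q * real CARD('n) / p))) < \<infinity>"
      from box_bound_imp_carleson[OF sets assms(3) pq c this]
      show "cs_embedding \<alpha> p q \<mu>" using carleson_embedding by blast
    qed
  qed
qed

end
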